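(* Let $W\subset\mathbb{R}^d$ ($d\geq 1$) be a non-empty compact convex set with $\lambda_d(W)>0$, and for $s\geq 1$ let $\eta_s$ be a Poisson process on $\mathbb{R}^d$ with intensity measure $s\lambda_d|_W$. Let $k\in\mathbb{N}$, and for $q\geq 0$ let $F_q=s^{q/d}L_q$, where $L_q$ is the edge length functional of power $q$ of the $k$-nearest neighbour graph generated by $\eta_s$. Let $n\in\mathbb{N}$ and let $q_1,\dots,q_n\geq 0$ be distinct. Then for $s\to\infty$ the asymptotic covariance matrix of $\frac{1}{\sqrt{s}}(F_{q_1},\dots,F_{q_n})$ is positive definite, i.e. for any $\alpha=(\alpha_1,\dots,\alpha_n)\in\mathbb{R}^n\setminus\{0\}$ there exists a constant $c>0$ such that for all $s$ sufficiently large $$\mathrm{Var}\left[\sum_{i=1}^n\alpha_iF_{q_i}\right]\geq cs.$$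
   Context: $\lambda_d$ is $d$-dimensional Lebesgue measure and $\lambda_d|_W$ its restriction to $W$. The point process $\eta_s$ is identified with the random set of its points. For $y\in\eta_s$, $N(y,\eta_s)$ denotes the set of the $k$ nearest neighbours of $y$ in $\eta_s\setminus\{y\}$ (Euclidean distance; almost surely there are no ties), i.e. the set of all $z\in\eta_s\setminus\{y\}$ such that the closed ball centred at $y$ with radius $\lVert y-z\rVert$ contains at most $k$ points of $\eta_s\setminus\{y\}$. The $k$-nearest neighbour graph generated by $\eta_s$ is the undirected graph with vertex set $\eta_s$ in which each vertex is connected to its $k$ nearest neighbours, i.e. $y\neq z$ are joined iff $z\in N(y,\eta_s)$ or $y\in N(z,\eta_s)$. The edge length functional of power $q\ge 0$ is $$L_q=\frac{1}{2}\sum_{(y,z)\in\eta_{s,\neq}^2}\mathbf{1}\{z\in N(y,\eta_s)\text{ or }y\in N(z,\eta_s)\}\lVert y-z\rVert^q,$$ where $\eta_{s,\neq}^2$ is the set of all ordered pairs of distinct points of $\eta_s$. "The asymptotic covariance matrix is positive definite" is to be understood as the variance lower bound stated after "i.e.". *)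

theory Defs
  imports "HOL-Probability.Probability"
begin

definition point_count :: "'a set \<Rightarrow> 'a set \<Rightarrow> ennreal" where
  "point_count B X = emeasure (count_space UNIV) (X \<inter> B)"

text \<open>
  A simple Poisson process, given as the random set of its points. This encoding is adequate
  for intensity measures without atoms, for which a Poisson process almost surely has no
  multiple points. A Poisson variable with parameter \<open>\<infinity>\<close> is almost surely infinite, and one with
  parameter \<open>0\<close> is almost surely \<open>0\<close> (the formula covers this case, as \<open>0 ^ 0 = 1\<close>).
\<close>
definition poisson_process :: "'w measure \<Rightarrow> 'a measure \<Rightarrow> ('w \<Rightarrow> 'a set) \<Rightarrow> bool" where
  "poisson_process M \<mu> \<eta> \<longleftrightarrow>
     prob_space M \<and>
     (\<forall>B\<in>sets \<mu>. (\<lambda>\<omega>. point_count B (\<eta> \<omega>)) \<in> borel_measurable M) \<and>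
     (\<forall>B\<in>sets \<mu>. emeasure \<mu> B < \<infinity> \<longrightarrow>
        (\<forall>j::nat. measure M {\<omega>\<in>space M. point_count B (\<eta> \<omega>) = of_nat j}
                  = exp (- measure \<mu> B) * measure \<mu> B ^ j / fact j)) \<and>
     (\<forall>B\<in>sets \<mu>. emeasure \<mu> B = \<infinity> \<longrightarrow> (AE \<omega> in M. point_count B (\<eta> \<omega>) = \<infinity>)) \<and>
     (\<forall>(I::nat set) B. finite I \<longrightarrow> (\<forall>i\<in>I. B i \<in> sets \<mu>) \<longrightarrow> disjoint_family_on B I \<longrightarrow>
        prob_space.indep_vars M (\<lambda>_. borel) (\<lambda>i \<omega>. point_count (B i) (\<eta> \<omega>)) I)"

text \<open>The finiteness condition is needed because \<open>card\<close> is \<open>0\<close> on infinite sets.\<close>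
definition nearest_neighbours :: "nat \<Rightarrow> 'a::metric_space \<Rightarrow> 'a set \<Rightarrow> 'a set" where
  "nearest_neighbours k y X =
     {z \<in> X - {y}. finite (cball y (dist y z) \<inter> (X - {y})) \<and>
                   card (cball y (dist y z) \<inter> (X - {y})) \<le> k}"

definition knn_adjacent :: "nat \<Rightarrow> 'a::metric_space set \<Rightarrow> 'a \<Rightarrow> 'a \<Rightarrow> bool" where
  "knn_adjacent k X y z \<longleftrightarrow> y \<in> X \<and> z \<in> X \<and> y \<noteq> z \<and>
     (z \<in> nearest_neighbours k y X \<or> y \<in> nearest_neighbours k z X)"

text \<open>
  The sum is over ordered pairs, hence the factor \<open>1/2\<close>. It is \<open>0\<close> by convention if \<open>X\<close> is
  infinite, which for a Poisson process of finite intensity measure has probability \<open>0\<close>.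
  Since \<open>norm (y - z) > 0\<close> in every term, \<open>powr\<close> with exponent \<open>0\<close> yields \<open>1\<close>.
\<close>
definition edge_length :: "nat \<Rightarrow> real \<Rightarrow> 'a::real_normed_vector set \<Rightarrow> real" where
  "edge_length k q X =
     1 / 2 * (\<Sum>(y, z)\<in>{(y, z). y \<in> X \<and> z \<in> X \<and> y \<noteq> z}.
                of_bool (knn_adjacent k X y z) * norm (y - z) powr q)"

end

(*
  A weighted sum H of the functionals F_q is correlated with a sum of order s many uncorrelated,
  bounded test functions Y_x, and Var H >= Cov(H, sum Y_x)^2 / Var(sum Y_x). The points x form a
  grid of mesh of order t = r s^(-1/d) in a ball inside W. Near x, two events are compared: a core
  of two small balls contains either 1 and k points, or none; in both cases the core is surrounded
  by an empty shell and by clusters of k + 2 points in sufficiently many directions, so that no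
  edge leaves the core. Hence passing from the second event to the first adds to H exactly the
  complete graph on the k + 1 core points. Its edges have lengths at most r s^(-1/d), and for
  small r the generalized polynomial sum_i alpha_i tau^(q_i) is dominated on (0, r] by its term of
  lowest exponent, so the gain has a fixed sign and is bounded away from 0. By scaling, the
  probabilities of these events do not depend on s and x.
*)
theory Submission
  imports Defs
begin

text \<open>The gain from filling the core must stay away from 0, but \<open>k + 1\<close> points in
  a single ball may lie arbitrarily close together, and for a positive lowest exponent their edges
  then contribute almost nothing. Two separated balls, with 1 and \<open>k\<close> points, force an
  edge of length at least \<open>t / 8\<close>. The empty core serves as reference because deleting
  the core leaves a functional of the points outside of it, which is independent of the counts in
  the core; the expectation of its product with a test function is therefore exactly 0, and it does
  not matter how far the influence of a point reaches in the graph. Test functions at different grid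
  points are uncorrelated for the same reason. Keeping the grid inside a ball in \<open>W\<close>
  avoids boundary effects. The technical obstacle is that a Poisson process is known only through
  its counts on Borel sets: a functional of the points outside of the core must be shown measurable
  with respect to these counts alone. This is why edge lengths are rewritten as nested sums over the
  random set, and why independence is extended from disjoint sets to generated
  sigma-algebras.\<close>

subsection \<open>Isolated clusters in the nearest neighbour graph\<close>

text \<open>A point of \<open>C\<close> meets its \<open>k\<close> companions before any other
  point, so it selects exactly these. A point outside of \<open>C\<close> has more than
  \<open>k\<close> other points of \<open>X - C\<close> at least as close as any point of
  \<open>C\<close>, so it never selects a point of \<open>C\<close>, and deleting \<open>C\<close>
  does not alter its choices.\<close>

lemma knn_adjacent_cluster:
  fixes X C :: "'a::metric_space set"
  assumes fin: "finite X" and card_C: "card (X \<inter> C) = k + 1"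
    and near: "\<And>y z w. y \<in> X \<inter> C \<Longrightarrow> z \<in> X \<inter> C \<Longrightarrow> w \<in> X - C \<Longrightarrow> dist y z < dist y w"
    and far: "\<And>y z. y \<in> X - C \<Longrightarrow> z \<in> X \<inter> C \<Longrightarrow>
                card (cball y (dist y z) \<inter> (X - C - {y})) > k"
    and yz: "y \<in> X" "z \<in> X"
  shows "knn_adjacent k X y z \<longleftrightarrow>
           (y \<in> C \<and> z \<in> C \<and> y \<noteq> z) \<or> knn_adjacent k (X - C) y z"
proof -
  have nn_CC: "z \<in> nearest_neighbours k y X"
    if "y \<in> X \<inter> C" "z \<in> X \<inter> C" "y \<noteq> z" for y z
  proof -
    have "cball y (dist y z) \<inter> (X - {y}) \<subseteq> X \<inter> C - {y}"
      using near[OF that(1,2)] by force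
    then have "card (cball y (dist y z) \<inter> (X - {y})) \<le> card (X \<inter> C - {y})"
      using fin by (intro card_mono) auto
    also have "\<dots> = k" using that card_C fin by simp
    finally show ?thesis using that fin by (simp add: nearest_neighbours_def)
  qed
  have nn_C: "z \<notin> nearest_neighbours k y X" if "y \<in> X \<inter> C" "z \<in> X - C" for y z
  proof -
    have "insert z (X \<inter> C - {y}) \<subseteq> cball y (dist y z) \<inter> (X - {y})"
      using near[OF that(1) _ that(2), THEN less_imp_le] that by auto
    then have "card (insert z (X \<inter> C - {y})) \<le> card (cball y (dist y z) \<inter> (X - {y}))"
      using fin by (intro card_mono) auto
    moreover have "card (insert z (X \<inter> C - {y})) = k + 1"
      using that card_C fin by simp
    ultimately show ?thesis by (simp add: nearest_neighbours_def)
  qed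
  have nn_far: "k < card (cball y r \<inter> (X - C - {y}))"
    if "y \<in> X - C" "z \<in> X \<inter> C" "dist y z \<le> r" for y z r
  proof -
    have "card (cball y (dist y z) \<inter> (X - C - {y})) \<le> card (cball y r \<inter> (X - C - {y}))"
      using fin that by (intro card_mono) auto
    with far[OF that(1,2)] show ?thesis by linarith
  qed
  have card_le: "card (cball y r \<inter> (X - C - {y})) \<le> card (cball y r \<inter> (X - {y}))" for y r
    using fin by (intro card_mono) auto
  have nn_D: "z \<notin> nearest_neighbours k y X" if "y \<in> X - C" "z \<in> X \<inter> C" for y z
    using nn_far[OF that order_refl] card_le[of y "dist y z"]
    by (simp add: nearest_neighbours_def)
  have nn_DD: "z \<in> nearest_neighbours k y X \<longleftrightarrow> z \<in> nearest_neighbours k y (X - C)"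
    if "y \<in> X - C" "z \<in> X - C" for y z
  \<comment> \<open>A ball that reaches \<open>C\<close> already contains more than \<open>k\<close>
    points of \<open>X - C\<close>, so \<open>z\<close> is rejected with and without
    \<open>C\<close>; a ball that does not reach \<open>C\<close> contains the same points in both
    cases.\<close>
  proof (cases "\<exists>w\<in>X \<inter> C. dist y w \<le> dist y z")
    case True
    then show ?thesis
      using nn_far[OF that(1)] card_le[of y "dist y z"] that
      by (fastforce simp: nearest_neighbours_def)
  next
    case False
    then have "cball y (dist y z) \<inter> (X - {y}) = cball y (dist y z) \<inter> (X - C - {y})"
      by auto
    then show ?thesis using that by (auto simp: nearest_neighbours_def)
  qed
  show ?thesis
  proof (cases "y = z")
    case True
    then show ?thesis by (simp add: knn_adjacent_def)
  next
    case False
    then show ?thesis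
      using yz nn_CC[of y z] nn_C[of y z] nn_C[of z y] nn_D[of y z] nn_D[of z y]
        nn_DD[of y z] nn_DD[of z y]
      by (cases "y \<in> C"; cases "z \<in> C") (auto simp: knn_adjacent_def)
  qed
qed

text \<open>The two kinds of edges in \<open>knn_adjacent_cluster\<close> exclude each other, since
  no edge of the graph on \<open>X - C\<close> touches \<open>C\<close>; so the indicator of an edge
  splits into a sum.\<close>

lemma edge_length_cluster:
  fixes X C :: "'a::real_normed_vector set"
  assumes fin: "finite X" and card_C: "card (X \<inter> C) = k + 1"
    and near: "\<And>y z w. y \<in> X \<inter> C \<Longrightarrow> z \<in> X \<inter> C \<Longrightarrow> w \<in> X - C \<Longrightarrow> dist y z < dist y w"
    and far: "\<And>y z. y \<in> X - C \<Longrightarrow> z \<in> X \<inter> C \<Longrightarrow>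
                card (cball y (dist y z) \<inter> (X - C - {y})) > k"
  shows "edge_length k q X = edge_length k q (X - C) +
           1 / 2 * (\<Sum>(y, z)\<in>{(y, z). y \<in> X \<inter> C \<and> z \<in> X \<inter> C \<and> y \<noteq> z}. norm (y - z) powr q)"
proof -
  let ?P = "\<lambda>A. {(y, z). y \<in> A \<and> z \<in> A \<and> y \<noteq> z}"
  let ?g = "\<lambda>A (y, z). of_bool (knn_adjacent k A y z) * norm (y - z) powr q"
  have fin2: "finite (?P X)"
    by (rule finite_subset[of _ "X \<times> X"]) (use fin in auto)
  have not_adj: "\<not> knn_adjacent k (X - C) y z" if "y \<in> C \<or> z \<in> C" for y z
    using that by (auto simp: knn_adjacent_def)
  have "(\<Sum>p\<in>?P X. ?g X p) =
        (\<Sum>p\<in>?P X. ?g (X - C) p + of_bool (p \<in> ?P (X \<inter> C)) * (\<lambda>(y, z). norm (y - z) powr q) p)"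
  proof (intro sum.cong refl)
    fix p assume "p \<in> ?P X"
    then obtain y z where p: "p = (y, z)" and yz: "y \<in> X" "z \<in> X" "y \<noteq> z" by auto
    show "?g X p = ?g (X - C) p + of_bool (p \<in> ?P (X \<inter> C)) * (\<lambda>(y, z). norm (y - z) powr q) p"
      using knn_adjacent_cluster[OF fin card_C near far yz(1,2)] not_adj[of y z] yz
      by (auto simp: p)
  qed
  also have "\<dots> = (\<Sum>p\<in>?P X. ?g (X - C) p) +
      (\<Sum>p\<in>?P X. of_bool (p \<in> ?P (X \<inter> C)) * (\<lambda>(y, z). norm (y - z) powr q) p)"
    by (rule sum.distrib)
  also have "(\<Sum>p\<in>?P X. ?g (X - C) p) = (\<Sum>p\<in>?P (X - C). ?g (X - C) p)"
    by (intro sum.mono_neutral_right fin2) (auto simp: knn_adjacent_def)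
  also have "(\<Sum>p\<in>?P X. of_bool (p \<in> ?P (X \<inter> C)) * (\<lambda>(y, z). norm (y - z) powr q) p) =
      (\<Sum>p\<in>?P (X \<inter> C). (\<lambda>(y, z). norm (y - z) powr q) p)"
    by (intro sum.mono_neutral_cong_right fin2) (auto simp: case_prod_beta)
  finally show ?thesis
    unfolding edge_length_def by (simp only: distrib_left)
qed

text \<open>Move from \<open>z\<close> radially to the sphere of radius \<open>t\<close>, then from
  there to \<open>t *\<^sub>R p\<close>; the closeness of the direction of \<open>z\<close> to
  \<open>p\<close> bounds the second move by \<open>t / 8\<close>.\<close>

lemma dist_unit_direction_le:
  fixes z p :: "'a::real_normed_vector"
  assumes "z \<noteq> 0" and "norm (z /\<^sub>R norm z - p) \<le> 1 / 8" and "t > 0"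
  shows "norm (z - t *\<^sub>R p) \<le> \<bar>norm z - t\<bar> + t / 8"
proof -
  have "z - t *\<^sub>R p = (norm z - t) *\<^sub>R (z /\<^sub>R norm z) + t *\<^sub>R (z /\<^sub>R norm z - p)"
    using assms(1) by (simp add: algebra_simps)
  then have "norm (z - t *\<^sub>R p) \<le> norm ((norm z - t) *\<^sub>R (z /\<^sub>R norm z)) + norm (t *\<^sub>R (z /\<^sub>R norm z - p))"
    by (metis norm_triangle_ineq)
  also have "\<dots> = \<bar>norm z - t\<bar> + t * norm (z /\<^sub>R norm z - p)"
    using assms(1,3) by (simp add: abs_mult)
  also have "t * norm (z /\<^sub>R norm z - p) \<le> t * (1 / 8)"
    using assms by (intro mult_left_mono) auto
  finally show ?thesis by simp
qed

text \<open>
  The shell condition isolates the core: from a point outside of the ball of radius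
  \<open>3 t / 4\<close>, one of the clusters around the points \<open>x + t *\<^sub>R p\<close> is closer than the core.
\<close>
lemma edge_length_isolated_core:
  fixes X C P :: "'a::real_normed_vector set"
  assumes fin: "finite X" and t: "t > 0" and card_C: "card (X \<inter> C) = k + 1"
    and C: "C \<subseteq> ball x (3 * t / 16)"
    and shell: "X \<inter> (ball x (3 * t / 4) - C) = {}"
    and net: "\<And>u. norm u = 1 \<Longrightarrow> \<exists>p\<in>P. norm (u - p) \<le> 1 / 8"
    and P: "\<And>p. p \<in> P \<Longrightarrow> norm p = 1" and \<delta>: "0 < \<delta>" "\<delta> \<le> 1 / 8"
    and clusters: "\<And>p. p \<in> P \<Longrightarrow> card (X \<inter> cball (x + t *\<^sub>R p) (t * \<delta>)) = k + 2"
  shows "edge_length k q X = edge_length k q (X - C) +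
           1 / 2 * (\<Sum>(y, z)\<in>{(y, z). y \<in> X \<inter> C \<and> z \<in> X \<inter> C \<and> y \<noteq> z}. norm (y - z) powr q)"
proof (rule edge_length_cluster[OF fin card_C])
  have out: "3 * t / 4 \<le> norm (y - x)" if "y \<in> X - C" for y
    using shell that by (auto simp: dist_norm norm_minus_commute not_less)
  have inC: "norm (y - x) < 3 * t / 16" if "y \<in> C" for y
    using C that by (auto simp: dist_norm norm_minus_commute)
  show "dist y z < dist y w" if "y \<in> X \<inter> C" "z \<in> X \<inter> C" "w \<in> X - C" for y z w
  proof -
    \<comment> \<open>Distances within the core are below \<open>3 * t / 8\<close>, those from the
      core to the other points above \<open>9 * t / 16\<close>.\<close>
    have "dist y z \<le> norm (y - x) + norm (z - x)"
      by (metis dist_norm dist_triangle2 norm_minus_commute dist_commute)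
    moreover have "norm (w - x) \<le> dist y w + norm (y - x)"
      by (metis dist_norm dist_triangle dist_commute)
    ultimately show ?thesis
      using inC[of y] inC[of z] out[of w] that t by auto
  qed
  show "card (cball y (dist y z) \<inter> (X - C - {y})) > k" if "y \<in> X - C" "z \<in> X \<inter> C" for y z
  proof -
    have ny: "3 * t / 4 \<le> norm (y - x)" and nz: "norm (z - x) < 3 * t / 16"
      using out inC that by auto
    then have y0: "y - x \<noteq> 0" using t by auto
    then obtain p where p: "p \<in> P" "norm ((y - x) /\<^sub>R norm (y - x) - p) \<le> 1 / 8"
      using net[of "(y - x) /\<^sub>R norm (y - x)"] by auto
    have d: "norm (y - x - t *\<^sub>R p) \<le> \<bar>norm (y - x) - t\<bar> + t / 8"
      using dist_unit_direction_le[OF y0 p(2) t] .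
    have dyz: "norm (y - x) - 3 * t / 16 < dist y z"
      using nz dist_triangle[of y x z] by (simp add: dist_norm norm_minus_commute)
    have t\<delta>: "t * \<delta> \<le> t / 8" using t \<delta> by simp
    have "w \<in> cball y (dist y z) - C" if "w \<in> cball (x + t *\<^sub>R p) (t * \<delta>)" for w
    proof -
      have w: "norm (x + t *\<^sub>R p - w) \<le> t / 8"
        using that t\<delta> by (simp add: dist_norm)
      have "norm (y - w) \<le> norm (y - x - t *\<^sub>R p) + norm (x + t *\<^sub>R p - w)"
        using norm_triangle_ineq[of "y - x - t *\<^sub>R p" "x + t *\<^sub>R p - w"] by simp
      then have "norm (y - w) \<le> \<bar>norm (y - x) - t\<bar> + t / 4"
        using d w by simp
      \<comment> \<open>For \<open>norm (y - x)\<close> below \<open>t\<close> this amounts to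
        \<open>norm (y - x) \<ge> 23 * t / 32\<close>; the shell radius \<open>3 * t / 4\<close> is
        just large enough.\<close>
      also have "\<dots> \<le> norm (y - x) - 3 * t / 16" using ny t by (auto simp: abs_if)
      finally have "dist y w \<le> dist y z" using dyz by (simp add: dist_norm)
      moreover have "w \<notin> C"
      proof
        assume "w \<in> C"
        then have "norm (w - x) < 3 * t / 16" by (rule inC)
        moreover have "norm (t *\<^sub>R p) = t" using P[OF p(1)] t by simp
        moreover have "norm (t *\<^sub>R p) \<le> norm (x + t *\<^sub>R p - w) + norm (w - x)"
          using norm_triangle_ineq[of "x + t *\<^sub>R p - w" "w - x"] by simp
        ultimately show False using w t by simp
      qed
      ultimately show ?thesis by simp
    qed
    then have "X \<inter> cball (x + t *\<^sub>R p) (t * \<delta>) - {y} \<subseteq> cball y (dist y z) \<inter> (X - C - {y})"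
      by auto
    then have "card (X \<inter> cball (x + t *\<^sub>R p) (t * \<delta>) - {y}) \<le> card (cball y (dist y z) \<inter> (X - C - {y}))"
      using fin by (intro card_mono) auto
    \<comment> \<open>\<open>y\<close> may itself be one of the points of the cluster and does not
      count as its own neighbour: hence \<open>k + 2\<close> points.\<close>
    moreover have "card (X \<inter> cball (x + t *\<^sub>R p) (t * \<delta>) - {y}) \<ge> k + 1"
      using card_Diff_singleton_if[of "X \<inter> cball (x + t *\<^sub>R p) (t * \<delta>)" y] clusters[OF p(1)]
      by auto
    ultimately show ?thesis by linarith
  qed
qed

subsection \<open>Measurability of sums over random sets\<close>

lemma point_count_eq_top: "infinite (X \<inter> B) \<Longrightarrow> point_count B X = \<infinity>"
  by (simp add: point_count_def)

lemma point_count_eq_of_nat: "finite (X \<inter> B) \<Longrightarrow> point_count B X = of_nat (card (X \<inter> B))"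
  by (simp add: point_count_def emeasure_count_space_finite)

lemma point_count_UNIV_finite_iff: "point_count UNIV X < \<infinity> \<longleftrightarrow> finite X"
proof (cases "finite X")
  case True
  then show ?thesis by (simp add: point_count_eq_of_nat of_nat_less_top)
next
  case False
  then show ?thesis by (simp add: point_count_eq_top)
qed

lemma point_count_eq_iff:
  "point_count B X = of_nat j \<longleftrightarrow> finite (X \<inter> B) \<and> card (X \<inter> B) = j"
proof (cases "finite (X \<inter> B)")
  case True
  then show ?thesis by (simp only: point_count_eq_of_nat of_nat_eq_iff) simp
next
  case False
  then show ?thesis using of_nat_less_top[of j] by (simp add: point_count_eq_top)
qed

lemma card_Int_eq_point_count: "real (card (X \<inter> B)) = enn2real (point_count B X)"
proof (cases "finite (X \<inter> B)")
  case True
  then show ?thesis by (simp add: point_count_eq_of_nat)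
next
  case False
  then show ?thesis by (simp add: point_count_eq_top)
qed

lemma card_eq_point_count: "real (card X) = enn2real (point_count UNIV X)"
  using card_Int_eq_point_count[of X UNIV] by simp

text \<open>The empirical distribution of the points turns sums over a random set into kernel integrals.\<close>
definition empirical_measure :: "'a::topological_space set \<Rightarrow> 'a measure" where
  "empirical_measure X =
     (if finite X \<and> X \<noteq> {} then distr (measure_pmf (pmf_of_set X)) borel id else null_measure borel)"

lemma sets_empirical_measure [simp]: "sets (empirical_measure X) = sets borel"
  by (simp add: empirical_measure_def)

lemma space_empirical_measure [simp]: "space (empirical_measure X) = UNIV"
  by (simp add: empirical_measure_def)

text \<open>The right-hand side involves \<open>X\<close> only through counts, which is what makes
  the kernel measurable. For empty \<open>X\<close> the quotient \<open>0 / 0\<close> is 0, in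
  agreement with the null measure.\<close>

lemma emeasure_empirical_measure:
  assumes "B \<in> sets borel"
  shows "emeasure (empirical_measure X) B =
           (if point_count UNIV X < \<infinity> then ennreal (enn2real (point_count B X) / enn2real (point_count UNIV X)) else 0)"
proof (cases "finite X \<and> X \<noteq> {}")
  case True
  then have "emeasure (empirical_measure X) B = emeasure (measure_pmf (pmf_of_set X)) B"
    using assms by (simp add: empirical_measure_def emeasure_distr)
  also have "\<dots> = ennreal (card (X \<inter> B) / card X)"
    using True by (simp add: emeasure_pmf_of_set)
  finally show ?thesis
    using True card_eq_point_count[of X] card_Int_eq_point_count[of X B]
    by (simp add: point_count_UNIV_finite_iff[unfolded infinity_ennreal_def])
next
  case False
  then show ?thesis
    by (auto simp: empirical_measure_def point_count_UNIV_finite_iff[unfolded infinity_ennreal_def] point_count_def)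
qed

lemma subprob_space_empirical_measure: "subprob_space (empirical_measure X)"
proof (rule subprob_spaceI)
  show "emeasure (empirical_measure X) (space (empirical_measure X)) \<le> 1"
  proof (cases "finite X \<and> X \<noteq> {}")
    case True
    then show ?thesis
      by (simp add: empirical_measure_def emeasure_distr measure_pmf.emeasure_space_1[simplified])
  next
    case False
    then show ?thesis by (auto simp: empirical_measure_def)
  qed
qed simp

lemma measurable_empirical_measure:
  fixes X :: "'w \<Rightarrow> 'a::topological_space set"
  assumes "\<And>B. B \<in> sets borel \<Longrightarrow> (\<lambda>\<omega>. point_count B (X \<omega>)) \<in> borel_measurable N"
  shows "(\<lambda>\<omega>. empirical_measure (X \<omega>)) \<in> N \<rightarrow>\<^sub>M subprob_algebra borel"
proof (rule measurable_subprob_algebra)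
  fix B :: "'a set" assume B: "B \<in> sets borel"
  have [measurable]: "(\<lambda>\<omega>. point_count B (X \<omega>)) \<in> borel_measurable N"
    "(\<lambda>\<omega>. point_count UNIV (X \<omega>)) \<in> borel_measurable N" using assms B by auto
  show "(\<lambda>\<omega>. emeasure (empirical_measure (X \<omega>)) B) \<in> borel_measurable N"
    unfolding emeasure_empirical_measure[OF B] by measurable
qed (auto simp: subprob_space_empirical_measure)

text \<open>The factor in front undoes the normalization. For infinite \<open>X\<close> both sides
  are 0: the sum by convention, the product because \<open>enn2real\<close> sends infinity to
  0.\<close>

lemma sum_eq_integral_empirical_measure:
  fixes f :: "'a::topological_space \<Rightarrow> real"
  assumes "f \<in> borel_measurable borel"
  shows "(\<Sum>y\<in>X. f y) = enn2real (point_count UNIV X) * integral\<^sup>L (empirical_measure X) f"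
proof (cases "finite X \<and> X \<noteq> {}")
  case True
  then have "integral\<^sup>L (empirical_measure X) f = integral\<^sup>L (measure_pmf (pmf_of_set X)) f"
    using assms by (simp add: empirical_measure_def integral_distr)
  also have "\<dots> = (\<Sum>y\<in>X. f y) / card X"
    using True by (simp add: integral_pmf_of_set)
  finally show ?thesis using True by (simp flip: card_eq_point_count)
next
  case False
  then show ?thesis by (auto simp flip: card_eq_point_count)
qed

text \<open>Pairing \<open>y\<close> with \<open>x\<close> moves the parameter from the integrand
  into the measure, so that one fixed function is integrated against a kernel.\<close>

lemma integral_measurable_subprob_kernel:
  fixes f :: "'a \<Rightarrow> 'b \<Rightarrow> real"
  assumes f [measurable]: "(\<lambda>(x, y). f x y) \<in> borel_measurable (M \<Otimes>\<^sub>M N)"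
    and L [measurable]: "L \<in> M \<rightarrow>\<^sub>M subprob_algebra N"
  shows "(\<lambda>x. integral\<^sup>L (L x) (f x)) \<in> borel_measurable M"
proof -
  have "(\<lambda>x. distr (L x) (M \<Otimes>\<^sub>M N) (\<lambda>y. (x, y))) \<in> M \<rightarrow>\<^sub>M subprob_algebra (M \<Otimes>\<^sub>M N)"
    by (rule measurable_distr2[OF _ L]) simp
  then have "(\<lambda>x. integral\<^sup>L (distr (L x) (M \<Otimes>\<^sub>M N) (\<lambda>y. (x, y))) (\<lambda>(x, y). f x y)) \<in> borel_measurable M"
    by (rule measurable_compose[OF _ integral_measurable_subprob_algebra[OF f]])
  moreover have "(\<lambda>x. integral\<^sup>L (distr (L x) (M \<Otimes>\<^sub>M N) (\<lambda>y. (x, y))) (\<lambda>(x, y). f x y)) \<in> borel_measurable M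
      \<longleftrightarrow> (\<lambda>x. integral\<^sup>L (L x) (f x)) \<in> borel_measurable M"
  proof (rule measurable_cong)
    fix x assume x: "x \<in> space M"
    then have "(\<lambda>y. (x, y)) \<in> N \<rightarrow>\<^sub>M M \<Otimes>\<^sub>M N" by simp
    then have "(\<lambda>y. (x, y)) \<in> L x \<rightarrow>\<^sub>M M \<Otimes>\<^sub>M N"
      by (simp only: measurable_cong_sets[OF sets_kernel[OF L x] refl])
    from integral_distr[OF this f]
    show "integral\<^sup>L (distr (L x) (M \<Otimes>\<^sub>M N) (\<lambda>y. (x, y))) (\<lambda>(x, y). f x y) = integral\<^sup>L (L x) (f x)"
      by simp
  qed
  ultimately show ?thesis by blast
qed

text \<open>The summand may depend on \<open>\<omega>\<close> and \<open>N\<close> is arbitrary, so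
  the lemma can be iterated: in a nested sum the outer summation points become coordinates of
  \<open>N\<close>.\<close>

lemma measurable_sum_random_set:
  fixes X :: "'w \<Rightarrow> 'a::topological_space set" and f :: "'w \<Rightarrow> 'a \<Rightarrow> real"
  assumes X: "\<And>B. B \<in> sets borel \<Longrightarrow> (\<lambda>\<omega>. point_count B (X \<omega>)) \<in> borel_measurable N"
    and f: "(\<lambda>(\<omega>, y). f \<omega> y) \<in> borel_measurable (N \<Otimes>\<^sub>M borel)"
  shows "(\<lambda>\<omega>. \<Sum>y\<in>X \<omega>. f \<omega> y) \<in> borel_measurable N"
proof -
  have [measurable]: "(\<lambda>\<omega>. integral\<^sup>L (empirical_measure (X \<omega>)) (f \<omega>)) \<in> borel_measurable N"
    by (rule integral_measurable_subprob_kernel[OF f measurable_empirical_measure[OF X]])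
  have [measurable]: "(\<lambda>\<omega>. point_count UNIV (X \<omega>)) \<in> borel_measurable N" using X by auto
  have "(\<lambda>\<omega>. \<Sum>y\<in>X \<omega>. f \<omega> y) \<in> borel_measurable N \<longleftrightarrow>
    (\<lambda>\<omega>. enn2real (point_count UNIV (X \<omega>)) * integral\<^sup>L (empirical_measure (X \<omega>)) (f \<omega>)) \<in> borel_measurable N"
  proof (rule measurable_cong)
    fix \<omega> assume "\<omega> \<in> space N"
    then have "f \<omega> \<in> borel_measurable borel"
      using measurable_Pair2[OF f] by simp
    then show "(\<Sum>y\<in>X \<omega>. f \<omega> y) =
        enn2real (point_count UNIV (X \<omega>)) * integral\<^sup>L (empirical_measure (X \<omega>)) (f \<omega>)"
      by (rule sum_eq_integral_empirical_measure)
  qed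
  then show ?thesis by simp
qed

section \<open>Measurability of the edge length functional\<close>

lemma infinite_off_diagonal:
  assumes "infinite X"
  shows "infinite {(y, z). y \<in> X \<and> z \<in> X \<and> y \<noteq> z}"
proof
  assume fin: "finite {(y, z). y \<in> X \<and> z \<in> X \<and> y \<noteq> z}"
  obtain y where y: "y \<in> X" using assms by (metis ex_in_conv finite.emptyI)
  have "X - {y} \<subseteq> snd ` {(y, z). y \<in> X \<and> z \<in> X \<and> y \<noteq> z}"
    using y by force
  then have "finite (X - {y})" using fin finite_surj by blast
  then show False using assms by simp
qed

lemma edge_length_infinite: "infinite X \<Longrightarrow> edge_length k q X = 0"
  by (simp add: edge_length_def infinite_off_diagonal)

text \<open>Being a nearest neighbour is a condition on a cardinality, and the cardinality is again
  a sum of indicators over \<open>X\<close>. In this form only nested sums over the random set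
  remain, to which \<open>measurable_sum_random_set\<close> applies.\<close>

lemma edge_length_eq_double_sum:
  fixes X :: "'a::real_normed_vector set"
  shows "edge_length k q X = 1 / 2 * (\<Sum>y\<in>X. \<Sum>z\<in>X.
     of_bool (y \<noteq> z \<and> ((\<Sum>w\<in>X. of_bool (w \<noteq> y \<and> dist y w \<le> dist y z)) \<le> real k \<or>
                        (\<Sum>w\<in>X. of_bool (w \<noteq> z \<and> dist z w \<le> dist y z)) \<le> real k)) *
     norm (y - z) powr q)"
proof (cases "finite X")
  case True
  have c: "(\<Sum>w\<in>X. of_bool (w \<noteq> y \<and> dist y w \<le> r)) = real (card (cball y r \<inter> (X - {y})))" for y r
  proof -
    have "(\<Sum>w\<in>X. of_bool (w \<noteq> y \<and> dist y w \<le> r)) = (\<Sum>w\<in>cball y r \<inter> (X - {y}). 1::real)"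
      by (rule sum.mono_neutral_cong_right) (use True in auto)
    then show ?thesis by simp
  qed
  have "(\<Sum>y\<in>X. \<Sum>z\<in>X.
     of_bool (y \<noteq> z \<and> ((\<Sum>w\<in>X. of_bool (w \<noteq> y \<and> dist y w \<le> dist y z)) \<le> real k \<or>
                        (\<Sum>w\<in>X. of_bool (w \<noteq> z \<and> dist z w \<le> dist y z)) \<le> real k)) *
     norm (y - z) powr q) = (\<Sum>(y, z)\<in>X \<times> X. of_bool (knn_adjacent k X y z) * norm (y - z) powr q)"
    unfolding sum.cartesian_product c
  proof (intro sum.cong refl)
    fix p assume "p \<in> X \<times> X"
    then obtain y z where p: "p = (y, z)" and yz: "y \<in> X" "z \<in> X" by auto
    have fin: "finite (cball y r \<inter> (X - {y}))" for y r using True by simp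
    have "y \<noteq> z \<and> (real (card (cball y (dist y z) \<inter> (X - {y}))) \<le> real k \<or>
        real (card (cball z (dist y z) \<inter> (X - {z}))) \<le> real k) \<longleftrightarrow> knn_adjacent k X y z"
      unfolding knn_adjacent_def nearest_neighbours_def
      using yz fin by (auto simp: dist_commute[of z y])
    then show "(case p of (y, z) \<Rightarrow> of_bool (y \<noteq> z \<and> (real (card (cball y (dist y z) \<inter> (X - {y}))) \<le> real k \<or>
        real (card (cball z (dist y z) \<inter> (X - {z}))) \<le> real k)) * norm (y - z) powr q) =
        (case p of (y, z) \<Rightarrow> of_bool (knn_adjacent k X y z) * norm (y - z) powr q)"
      by (simp add: p)
  qed
  also have "\<dots> = (\<Sum>(y, z)\<in>{(y, z). y \<in> X \<and> z \<in> X \<and> y \<noteq> z}.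
       of_bool (knn_adjacent k X y z) * norm (y - z) powr q)"
    by (rule sum.mono_neutral_right) (use True in \<open>auto simp: knn_adjacent_def\<close>)
  finally show ?thesis by (simp add: edge_length_def)
qed (simp add: edge_length_infinite)

lemma measurable_of_bool_real:
  "Measurable.pred N P \<Longrightarrow> (\<lambda>x. of_bool (P x) :: real) \<in> borel_measurable N"
  unfolding of_bool_def by measurable

lemma measurable_edge_length:
  fixes X :: "'w \<Rightarrow> 'a::euclidean_space set"
  assumes X: "\<And>B. B \<in> sets borel \<Longrightarrow> (\<lambda>\<omega>. point_count B (X \<omega>)) \<in> borel_measurable N"
  shows "(\<lambda>\<omega>. edge_length k q (X \<omega>)) \<in> borel_measurable N"
proof -
  note measurable_of_bool_real [measurable]
  \<comment> \<open>The sums are treated from the inside out. In a point \<open>p\<close> of this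
    space, \<open>fst (fst p)\<close> is \<open>\<omega>\<close>, \<open>snd (fst p)\<close> is the
    outer point \<open>y\<close> and \<open>snd p\<close> is the inner point
    \<open>z\<close>.\<close>
  let ?N2 = "(N \<Otimes>\<^sub>M borel) \<Otimes>\<^sub>M (borel :: 'a measure)"
  have X2: "(\<lambda>p. point_count B (X (fst (fst p)))) \<in> borel_measurable ?N2" if "B \<in> sets borel" for B
    using measurable_compose[OF measurable_compose[OF measurable_fst measurable_fst] X[OF that]] .
  have X1: "(\<lambda>p. point_count B (X (fst p))) \<in> borel_measurable (N \<Otimes>\<^sub>M (borel :: 'a measure))" if "B \<in> sets borel" for B
    using measurable_compose[OF measurable_fst X[OF that]] .
  have m1: "(\<lambda>p. \<Sum>w\<in>X (fst (fst p)). of_bool (w \<noteq> snd (fst p) \<and> dist (snd (fst p)) w \<le> dist (snd (fst p)) (snd p)) :: real)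
      \<in> borel_measurable ?N2"
    by (rule measurable_sum_random_set, erule X2, unfold case_prod_beta, measurable)
  have m2: "(\<lambda>p. \<Sum>w\<in>X (fst (fst p)). of_bool (w \<noteq> snd p \<and> dist (snd p) w \<le> dist (snd (fst p)) (snd p)) :: real)
      \<in> borel_measurable ?N2"
    by (rule measurable_sum_random_set, erule X2, unfold case_prod_beta, measurable)
  have summand: "(\<lambda>p. of_bool (snd (fst p) \<noteq> snd p \<and> (c p \<le> real k \<or> c' p \<le> real k)) *
      norm (snd (fst p) - snd p) powr q) \<in> borel_measurable ?N2"
    if [measurable]: "c \<in> borel_measurable ?N2" "c' \<in> borel_measurable ?N2" for c c'
    by measurable
  have m3: "(\<lambda>p. \<Sum>z\<in>X (fst p).
     of_bool (snd p \<noteq> z \<and> ((\<Sum>w\<in>X (fst p). of_bool (w \<noteq> snd p \<and> dist (snd p) w \<le> dist (snd p) z)) \<le> real k \<or>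
                        (\<Sum>w\<in>X (fst p). of_bool (w \<noteq> z \<and> dist z w \<le> dist (snd p) z)) \<le> real k)) *
     norm (snd p - z) powr q) \<in> borel_measurable (N \<Otimes>\<^sub>M (borel :: 'a measure))"
    by (rule measurable_sum_random_set, erule X1, unfold case_prod_beta, rule summand[OF m1 m2])
  have "(\<lambda>\<omega>. \<Sum>y\<in>X \<omega>. \<Sum>z\<in>X \<omega>.
     of_bool (y \<noteq> z \<and> ((\<Sum>w\<in>X \<omega>. of_bool (w \<noteq> y \<and> dist y w \<le> dist y z)) \<le> real k \<or>
                        (\<Sum>w\<in>X \<omega>. of_bool (w \<noteq> z \<and> dist z w \<le> dist y z)) \<le> real k)) *
     norm (y - z) powr q) \<in> borel_measurable N"
    by (rule measurable_sum_random_set, erule X, unfold case_prod_beta, rule m3)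
  then show ?thesis
    unfolding edge_length_eq_double_sum by (rule borel_measurable_times[OF borel_measurable_const])
qed

subsection \<open>Independence in Poisson processes\<close>

lemma point_count_Int: "point_count B (X \<inter> D) = point_count (B \<inter> D) X"
  by (simp add: point_count_def Int_ac)

lemma point_count_UN_disjoint:
  assumes "finite I" and "disjoint_family_on A I"
  shows "point_count (\<Union>i\<in>I. A i) X = (\<Sum>i\<in>I. point_count (A i) X)"
proof -
  have "disjoint_family_on (\<lambda>i. X \<inter> A i) I"
    using assms(2) by (auto simp: disjoint_family_on_def)
  then show ?thesis
    unfolding point_count_def Int_UN_distrib using assms(1)
    by (intro sum_emeasure[symmetric]) auto
qed

text \<open>In \<open>poisson_process\<close> independence refers to families indexed by natural
  numbers; this carries it over to the other index types that occur below, such as sums and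
  options.\<close>

lemma (in prob_space) indep_vars_reindex:
  assumes f: "inj_on f I" and ind: "indep_vars N Y (f ` I)"
  shows "indep_vars (\<lambda>i. N (f i)) (\<lambda>i. Y (f i)) I"
  unfolding indep_vars_def2
proof (intro conjI ballI indep_setsI)
  show rv: "random_variable (N (f i)) (Y (f i))" if "i \<in> I" for i
    using ind that by (auto simp: indep_vars_def2)
  show "{Y (f i) -` A \<inter> space M |A. A \<in> sets (N (f i))} \<subseteq> events" if "i \<in> I" for i
    using measurable_sets[OF rv[OF that]] by auto
  fix A J assume J: "J \<noteq> {}" "J \<subseteq> I" "finite J"
    and A: "\<forall>j\<in>J. A j \<in> {Y (f j) -` B \<inter> space M |B. B \<in> sets (N (f j))}"
  have fJ: "inj_on f J" using f J(2) by (rule inj_on_subset)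
  let ?A = "\<lambda>i. A (the_inv_into J f i)"
  have A': "?A (f j) = A j" if "j \<in> J" for j using the_inv_into_f_f[OF fJ that] by simp
  have "prob (\<Inter>i\<in>f ` J. ?A i) = (\<Prod>i\<in>f ` J. prob (?A i))"
  proof (rule indep_setsD)
    show "indep_sets (\<lambda>i. {Y i -` B \<inter> space M |B. B \<in> sets (N i)}) (f ` I)"
      using ind by (simp add: indep_vars_def2)
    show "\<forall>i\<in>f ` J. ?A i \<in> {Y i -` B \<inter> space M |B. B \<in> sets (N i)}"
    proof
      fix i assume "i \<in> f ` J"
      then obtain j where j: "j \<in> J" "i = f j" by blast
      show "?A i \<in> {Y i -` B \<inter> space M |B. B \<in> sets (N i)}"
        unfolding j(2) A'[OF j(1)] by (rule bspec[OF A j(1)])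
    qed
  qed (use J in auto)
  moreover have "(\<Inter>i\<in>f ` J. ?A i) = (\<Inter>j\<in>J. A j)"
    unfolding image_image using A' by (intro INF_cong refl)
  moreover have "(\<Prod>i\<in>f ` J. prob (?A i)) = (\<Prod>j\<in>J. prob (A j))"
    unfolding prod.reindex[OF fJ] comp_def using A' by (intro prod.cong refl) simp
  ultimately show "prob (\<Inter>j\<in>J. A j) = (\<Prod>j\<in>J. prob (A j))" by simp
qed

text \<open>
  Independence is only assumed for disjoint sets; overlapping sets are split into the atoms that
  they generate. The second component of the elements of \<open>\<F>\<close> is carried along for \<open>cylinders\<close> below.
\<close>
definition atom :: "'a set \<Rightarrow> ('a set \<times> 'b) set \<Rightarrow> ('a set \<times> 'b) set \<Rightarrow> 'a set" where
  "atom D \<F> J = {y\<in>D. {p\<in>\<F>. y \<in> fst p} = J}"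

lemma disjoint_atom: "J \<noteq> J' \<Longrightarrow> atom D \<F> J \<inter> atom D \<F> J' = {}"
  by (auto simp: atom_def)

lemma atom_measurable:
  assumes "finite \<F>" and "D \<in> sets N" and "\<And>p. p \<in> \<F> \<Longrightarrow> fst p \<in> sets N" and "J \<subseteq> \<F>"
  shows "atom D \<F> J \<in> sets N"
proof -
  have "atom D \<F> J = (D \<inter> (space N \<inter> (\<Inter>p\<in>J. fst p))) - (\<Union>p\<in>\<F> - J. fst p)"
    using assms(4) sets.sets_into_space[OF assms(2)] by (auto simp: atom_def)
  moreover have "space N \<inter> (\<Inter>p\<in>J. fst p) \<in> sets N"
  proof (cases "J = {}")
    case False
    then show ?thesis
      using assms by (intro sets.Int sets.top sets.finite_INT) (auto intro: finite_subset)
  qed simp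
  moreover have "(\<Union>p\<in>\<F> - J. fst p) \<in> sets N"
    using assms by (intro sets.finite_UN) auto
  ultimately show ?thesis using assms(2) by auto
qed

lemma point_count_eq_sum_atoms:
  assumes "finite \<F>" and "p \<in> \<F>" and "fst p \<subseteq> D"
  shows "point_count (fst p) X = (\<Sum>J\<in>{J\<in>Pow \<F>. p \<in> J}. point_count (atom D \<F> J) X)"
proof -
  have "fst p = (\<Union>J\<in>{J\<in>Pow \<F>. p \<in> J}. atom D \<F> J)"
  proof (rule set_eqI)
    fix y
    show "y \<in> fst p \<longleftrightarrow> y \<in> (\<Union>J\<in>{J\<in>Pow \<F>. p \<in> J}. atom D \<F> J)"
      using assms(2,3) by (auto simp: atom_def)
  qed
  then have "point_count (fst p) X = point_count (\<Union>J\<in>{J\<in>Pow \<F>. p \<in> J}. atom D \<F> J) X"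
    by (rule arg_cong)
  also have "\<dots> = (\<Sum>J\<in>{J\<in>Pow \<F>. p \<in> J}. point_count (atom D \<F> J) X)"
    using assms(1) by (intro point_count_UN_disjoint) (auto simp: disjoint_family_on_def disjoint_atom)
  finally show ?thesis .
qed

locale finite_poisson_process = prob_space M for M :: "'w measure" +
  fixes \<mu> :: "'a::euclidean_space measure" and X :: "'w \<Rightarrow> 'a set"
  assumes poisson: "poisson_process M \<mu> X" and sets_intensity [simp]: "sets \<mu> = sets borel"
    and finite_intensity: "emeasure \<mu> UNIV < \<infinity>"
begin

lemma measurable_point_count [measurable]:
  "B \<in> sets borel \<Longrightarrow> (\<lambda>\<omega>. point_count B (X \<omega>)) \<in> borel_measurable M"
  using poisson by (auto simp: poisson_process_def)

lemma prob_point_count: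
  assumes "B \<in> sets borel"
  shows "prob {\<omega>\<in>space M. point_count B (X \<omega>) = of_nat j} =
           exp (- measure \<mu> B) * measure \<mu> B ^ j / fact j"
proof -
  have "emeasure \<mu> B \<le> emeasure \<mu> UNIV"
    using assms by (intro emeasure_mono) auto
  then have "emeasure \<mu> B < \<infinity>" using finite_intensity by (rule le_less_trans)
  then show ?thesis using poisson assms by (simp add: poisson_process_def)
qed

text \<open>The Poisson weights sum to 1 by the exponential series, so no probability is left for
  the value infinity.\<close>

lemma AE_point_count_nat:
  assumes "B \<in> sets borel"
  shows "AE \<omega> in M. \<exists>j. point_count B (X \<omega>) = of_nat j"
proof -
  let ?m = "measure \<mu> B"
  let ?A = "\<lambda>j::nat. {\<omega>\<in>space M. point_count B (X \<omega>) = of_nat j}"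
  have "(\<lambda>j. exp (- ?m) * (?m ^ j / fact j)) sums (exp (- ?m) * exp ?m)"
    using exp_converges[of ?m] by (intro sums_mult) (simp add: divide_inverse mult.commute)
  then have "(\<lambda>j. prob (?A j)) sums 1"
    using prob_point_count[OF assms] by (simp flip: exp_add)
  moreover have "(\<lambda>j. prob (?A j)) sums prob (\<Union>j. ?A j)"
    using assms by (intro finite_measure_UNION) (auto simp: disjoint_family_on_def)
  ultimately have "prob (\<Union>j. ?A j) = 1" by (rule sums_unique2[symmetric])
  moreover have "(\<Union>j. ?A j) \<in> events" using assms by (intro sets.countable_UN) auto
  ultimately have "AE \<omega> in M. \<omega> \<in> (\<Union>j. ?A j)" by (simp add: prob_eq_1)
  then show ?thesis by (rule AE_mp) auto
qed

lemma AE_finite: "AE \<omega> in M. finite (X \<omega>)"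
  using AE_point_count_nat[of UNIV] by (simp add: point_count_eq_iff)

lemma AE_Int_null_set_empty:
  assumes "B \<in> sets borel" and "measure \<mu> B = 0"
  shows "AE \<omega> in M. X \<omega> \<inter> B = {}"
proof -
  have "prob {\<omega>\<in>space M. point_count B (X \<omega>) = of_nat 0} = 1"
    using prob_point_count[OF assms(1), of 0] assms(2) by simp
  moreover have "{\<omega>\<in>space M. point_count B (X \<omega>) = of_nat 0} \<in> events"
    using assms(1) by measurable
  ultimately have "AE \<omega> in M. \<omega> \<in> {\<omega>\<in>space M. point_count B (X \<omega>) = of_nat 0}"
    by (simp add: prob_eq_1)
  then show ?thesis
  proof (rule eventually_mono)
    fix \<omega> assume "\<omega> \<in> {\<omega>\<in>space M. point_count B (X \<omega>) = of_nat 0}"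
    then have "finite (X \<omega> \<inter> B) \<and> card (X \<omega> \<inter> B) = 0"
      unfolding point_count_eq_iff by simp
    then show "X \<omega> \<inter> B = {}" using card_0_eq by blast
  qed
qed

lemma indep_vars_point_count:
  assumes K: "finite K" and B: "\<And>i. i \<in> K \<Longrightarrow> B i \<in> sets borel" and disj: "disjoint_family_on B K"
  shows "indep_vars (\<lambda>_. borel) (\<lambda>i \<omega>. point_count (B i) (X \<omega>)) K"
proof -
  obtain f and n :: nat where f: "bij_betw f K {..<n}"
    using ex_bij_betw_finite_nat[OF K] by (auto simp: atLeast0LessThan)
  let ?g = "the_inv_into K f"
  have g: "?g (f i) = i" if "i \<in> K" for i
    using that f by (auto simp: bij_betw_def the_inv_into_f_f)
  have disj': "disjoint_family_on (\<lambda>i. B (?g i)) (f ` K)"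
    unfolding disjoint_family_on_def
  proof (intro ballI impI)
    fix m n assume "m \<in> f ` K" "n \<in> f ` K" "m \<noteq> n"
    then obtain i j where "m = f i" "n = f j" "i \<in> K" "j \<in> K" "i \<noteq> j" by blast
    then show "B (?g m) \<inter> B (?g n) = {}"
      using disj g[of i] g[of j] by (simp add: disjoint_family_on_def)
  qed
  have "indep_vars (\<lambda>_. borel) (\<lambda>i \<omega>. point_count (B (?g i)) (X \<omega>)) (f ` K)"
  proof -
    have P: "\<forall>(I::nat set) B. finite I \<longrightarrow> (\<forall>i\<in>I. B i \<in> sets \<mu>) \<longrightarrow> disjoint_family_on B I \<longrightarrow>
        indep_vars (\<lambda>_. borel) (\<lambda>i \<omega>. point_count (B i) (X \<omega>)) I"
      using poisson unfolding poisson_process_def by (elim conjE)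
    have "\<forall>i\<in>f ` K. B (?g i) \<in> sets \<mu>" using B g by simp
    from P[rule_format, OF finite_imageI[OF K] this[rule_format] disj'] show ?thesis .
  qed
  then have "indep_vars (\<lambda>i. borel) (\<lambda>i. (\<lambda>i \<omega>. point_count (B (?g i)) (X \<omega>)) (f i)) K"
    by (rule indep_vars_reindex[OF bij_betw_imp_inj_on[OF f]])
  moreover have "indep_vars (\<lambda>i. borel) (\<lambda>i. (\<lambda>i \<omega>. point_count (B (?g i)) (X \<omega>)) (f i)) K \<longleftrightarrow>
      indep_vars (\<lambda>_. borel) (\<lambda>i \<omega>. point_count (B i) (X \<omega>)) K"
    by (rule indep_vars_cong) (simp_all add: g)
  ultimately show ?thesis by (rule iffD1[rotated])
qed

lemma prob_point_counts:
  assumes "finite K" and "K \<noteq> {}" and "\<And>i. i \<in> K \<Longrightarrow> B i \<in> sets borel" and "disjoint_family_on B K"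
  shows "prob {\<omega>\<in>space M. \<forall>i\<in>K. point_count (B i) (X \<omega>) = of_nat (j i)} =
           (\<Prod>i\<in>K. exp (- measure \<mu> (B i)) * measure \<mu> (B i) ^ j i / fact (j i))"
proof -
  have "prob (\<Inter>i\<in>K. (\<lambda>\<omega>. point_count (B i) (X \<omega>)) -` {of_nat (j i)} \<inter> space M) =
        (\<Prod>i\<in>K. prob ((\<lambda>\<omega>. point_count (B i) (X \<omega>)) -` {of_nat (j i)} \<inter> space M))"
    using assms by (intro indep_varsD[OF indep_vars_point_count[of K B]]) auto
  also have "(\<Inter>i\<in>K. (\<lambda>\<omega>. point_count (B i) (X \<omega>)) -` {of_nat (j i)} \<inter> space M) =
      {\<omega>\<in>space M. \<forall>i\<in>K. point_count (B i) (X \<omega>) = of_nat (j i)}"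
    using assms(2) by auto
  also have "(\<Prod>i\<in>K. prob ((\<lambda>\<omega>. point_count (B i) (X \<omega>)) -` {of_nat (j i)} \<inter> space M)) =
      (\<Prod>i\<in>K. exp (- measure \<mu> (B i)) * measure \<mu> (B i) ^ j i / fact (j i))"
  proof (rule prod.cong[OF refl])
    fix i assume "i \<in> K"
    moreover have "(\<lambda>\<omega>. point_count (B i) (X \<omega>)) -` {of_nat (j i)} \<inter> space M =
        {\<omega>\<in>space M. point_count (B i) (X \<omega>) = of_nat (j i)}" by auto
    ultimately show "prob ((\<lambda>\<omega>. point_count (B i) (X \<omega>)) -` {of_nat (j i)} \<inter> space M) =
        exp (- measure \<mu> (B i)) * measure \<mu> (B i) ^ j i / fact (j i)"
      using prob_point_count[OF assms(3)] by simp
  qed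
  finally show ?thesis .
qed

section \<open>The information carried by the points in a region, and its independence for disjoint
  regions\<close>

definition cylinders :: "'a set \<Rightarrow> 'w set set" where
  "cylinders D = {{\<omega>\<in>space M. \<forall>p\<in>\<F>. point_count (fst p) (X \<omega>) \<in> snd p} | \<F>.
      finite \<F> \<and> (\<forall>p\<in>\<F>. fst p \<in> sets borel \<and> fst p \<subseteq> D \<and> snd p \<in> sets (borel :: ennreal measure))}"

text \<open>The sigma-algebra generated by the restriction of the process to \<open>D\<close>. Its
  generator admits finitely many conditions at once in order to be closed under intersections, so
  that independence can be checked on the generator.\<close>

definition inside :: "'a set \<Rightarrow> 'w measure" where
  "inside D = sigma (space M) (cylinders D)"

lemma cylindersI:
  assumes "finite \<F>" and "\<And>p. p \<in> \<F> \<Longrightarrow> fst p \<in> sets borel \<and> fst p \<subseteq> D \<and> snd p \<in> sets borel"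
  shows "{\<omega>\<in>space M. \<forall>p\<in>\<F>. point_count (fst p) (X \<omega>) \<in> snd p} \<in> cylinders D"
  using assms unfolding cylinders_def by blast

lemma cylinders_events: "cylinders D \<subseteq> events"
proof
  fix A assume "A \<in> cylinders D"
  then obtain \<F> where \<F>: "finite \<F>" "\<And>p. p \<in> \<F> \<Longrightarrow> fst p \<in> sets borel \<and> snd p \<in> sets borel"
    and A: "A = {\<omega>\<in>space M. \<forall>p\<in>\<F>. point_count (fst p) (X \<omega>) \<in> snd p}"
    unfolding cylinders_def by blast
  show "A \<in> events"
    unfolding A
  proof (rule sets.sets_Collect_finite_All[OF _ \<F>(1)])
    fix p assume "p \<in> \<F>"
    then have "(\<lambda>\<omega>. point_count (fst p) (X \<omega>)) -` snd p \<inter> space M \<in> events"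
      using \<F>(2) by (intro measurable_sets[OF measurable_point_count]) auto
    also have "(\<lambda>\<omega>. point_count (fst p) (X \<omega>)) -` snd p \<inter> space M =
        {\<omega>\<in>space M. point_count (fst p) (X \<omega>) \<in> snd p}" by auto
    finally show "{\<omega>\<in>space M. point_count (fst p) (X \<omega>) \<in> snd p} \<in> events" .
  qed
qed

lemma space_inside [simp]: "space (inside D) = space M"
  unfolding inside_def by (rule space_measure_of_conv)

lemma sets_inside: "sets (inside D) = sigma_sets (space M) (cylinders D)"
  unfolding inside_def using cylinders_events sets.space_closed by (intro sets_measure_of) blast

lemma measurable_point_count_inside:
  assumes "B \<in> sets borel" and "B \<subseteq> D"
  shows "(\<lambda>\<omega>. point_count B (X \<omega>)) \<in> borel_measurable (inside D)"
proof (rule measurableI)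
  fix S :: "ennreal set" assume S: "S \<in> sets borel"
  have "{\<omega>\<in>space M. \<forall>p\<in>{(B, S)}. point_count (fst p) (X \<omega>) \<in> snd p} \<in> cylinders D"
    using assms S by (intro cylindersI) auto
  also have "{\<omega>\<in>space M. \<forall>p\<in>{(B, S)}. point_count (fst p) (X \<omega>) \<in> snd p} =
      (\<lambda>\<omega>. point_count B (X \<omega>)) -` S \<inter> space (inside D)" by auto
  finally show "(\<lambda>\<omega>. point_count B (X \<omega>)) -` S \<inter> space (inside D) \<in> sets (inside D)"
    unfolding sets_inside by (rule sigma_sets.Basic)
qed simp

lemma Int_stable_cylinders: "Int_stable (cylinders D)"
proof (rule Int_stableI)
  fix A A' assume "A \<in> cylinders D" "A' \<in> cylinders D"
  then obtain \<F> \<F>' where F: "finite \<F>" "\<forall>p\<in>\<F>. fst p \<in> sets borel \<and> fst p \<subseteq> D \<and> snd p \<in> sets borel"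
      "A = {\<omega>\<in>space M. \<forall>p\<in>\<F>. point_count (fst p) (X \<omega>) \<in> snd p}"
    and F': "finite \<F>'" "\<forall>p\<in>\<F>'. fst p \<in> sets borel \<and> fst p \<subseteq> D \<and> snd p \<in> sets borel"
      "A' = {\<omega>\<in>space M. \<forall>p\<in>\<F>'. point_count (fst p) (X \<omega>) \<in> snd p}"
    unfolding cylinders_def by blast
  have "A \<inter> A' = {\<omega>\<in>space M. \<forall>p\<in>\<F> \<union> \<F>'. point_count (fst p) (X \<omega>) \<in> snd p}"
    unfolding F(3) F'(3) by blast
  also have "\<dots> \<in> cylinders D"
    using F(1,2) F'(1,2) by (intro cylindersI) auto
  finally show "A \<inter> A' \<in> cylinders D" .
qed

text \<open>The sets within one cylinder may overlap. The atoms of both families together are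
  pairwise disjoint, so their counts are independent, and each cylinder is an event about its own
  block of atom counts.\<close>

lemma indep_cylinders:
  assumes CD: "C \<in> sets borel" "D \<in> sets borel" "C \<inter> D = {}"
  shows "indep_set (cylinders C) (cylinders D)"
proof (rule indep_setI[OF cylinders_events cylinders_events])
  fix A A' assume "A \<in> cylinders C" "A' \<in> cylinders D"
  then obtain \<F> \<F>' where F: "finite \<F>" "\<forall>p\<in>\<F>. fst p \<in> sets borel \<and> fst p \<subseteq> C \<and> snd p \<in> sets borel"
      "A = {\<omega>\<in>space M. \<forall>p\<in>\<F>. point_count (fst p) (X \<omega>) \<in> snd p}"
    and F': "finite \<F>'" "\<forall>p\<in>\<F>'. fst p \<in> sets borel \<and> fst p \<subseteq> D \<and> snd p \<in> sets borel"
      "A' = {\<omega>\<in>space M. \<forall>p\<in>\<F>'. point_count (fst p) (X \<omega>) \<in> snd p}"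
    unfolding cylinders_def by blast
  \<comment> \<open>\<open>Inl\<close> and \<open>Inr\<close> keep the atoms of \<open>C\<close> and
    those of \<open>D\<close> apart even where their index sets coincide.\<close>
  define B where "B = case_sum (atom C \<F>) (atom D \<F>')"
  define N where "N = (\<lambda>i \<omega>. point_count (B i) (X \<omega>))"
  let ?K = "Inl ` Pow \<F>" and ?K' = "Inr ` Pow \<F>'"
  have disj: "disjoint_family_on B (?K \<union> ?K')"
    using CD(3) unfolding disjoint_family_on_def B_def
    by (auto simp: disjoint_atom) (auto simp: atom_def)
  have "indep_vars (\<lambda>_. borel) N (?K \<union> ?K')"
    unfolding N_def
  proof (rule indep_vars_point_count[OF _ _ disj])
    show "B i \<in> sets borel" if "i \<in> ?K \<union> ?K'" for i
      using that atom_measurable[OF F(1) CD(1)] atom_measurable[OF F'(1) CD(2)] F(2) F'(2)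
      by (auto simp: B_def)
  qed (use F(1) F'(1) in auto)
  then have iv: "indep_var (PiM ?K (\<lambda>_. borel)) (\<lambda>\<omega>. restrict (\<lambda>i. N i \<omega>) ?K)
      (PiM ?K' (\<lambda>_. borel)) (\<lambda>\<omega>. restrict (\<lambda>i. N i \<omega>) ?K')"
    by (rule indep_var_restrict) auto
  \<comment> \<open>The event \<open>A\<close> as a condition on the vector of atom counts: the
    count of each set is the sum over the atoms that it contains.\<close>
  let ?S = "{v\<in>space (PiM ?K (\<lambda>_. borel :: ennreal measure)).
      \<forall>p\<in>\<F>. (\<Sum>J\<in>{J\<in>Pow \<F>. p \<in> J}. v (Inl J)) \<in> snd p}"
  let ?S' = "{v\<in>space (PiM ?K' (\<lambda>_. borel :: ennreal measure)).
      \<forall>p\<in>\<F>'. (\<Sum>J\<in>{J\<in>Pow \<F>'. p \<in> J}. v (Inr J)) \<in> snd p}"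
  have mS: "?S \<in> sets (PiM ?K (\<lambda>_. borel))"
  proof (rule sets.sets_Collect_finite_All[OF _ F(1)])
    fix p assume "p \<in> \<F>"
    have m: "(\<lambda>v. \<Sum>J\<in>{J\<in>Pow \<F>. p \<in> J}. v (Inl J)) \<in> PiM ?K (\<lambda>_. borel :: ennreal measure) \<rightarrow>\<^sub>M borel"
      by (intro borel_measurable_sum measurable_component_singleton) auto
    show "{v\<in>space (PiM ?K (\<lambda>_. borel :: ennreal measure)). (\<Sum>J\<in>{J\<in>Pow \<F>. p \<in> J}. v (Inl J)) \<in> snd p}
        \<in> sets (PiM ?K (\<lambda>_. borel))"
      using measurable_sets[OF m, of "snd p"] F(2) \<open>p \<in> \<F>\<close> by (simp add: vimage_def Int_def conj_commute)
  qed
  have mS': "?S' \<in> sets (PiM ?K' (\<lambda>_. borel))"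
  proof (rule sets.sets_Collect_finite_All[OF _ F'(1)])
    fix p assume "p \<in> \<F>'"
    have m: "(\<lambda>v. \<Sum>J\<in>{J\<in>Pow \<F>'. p \<in> J}. v (Inr J)) \<in> PiM ?K' (\<lambda>_. borel :: ennreal measure) \<rightarrow>\<^sub>M borel"
      by (intro borel_measurable_sum measurable_component_singleton) auto
    show "{v\<in>space (PiM ?K' (\<lambda>_. borel :: ennreal measure)). (\<Sum>J\<in>{J\<in>Pow \<F>'. p \<in> J}. v (Inr J)) \<in> snd p}
        \<in> sets (PiM ?K' (\<lambda>_. borel))"
      using measurable_sets[OF m, of "snd p"] F'(2) \<open>p \<in> \<F>'\<close> by (simp add: vimage_def Int_def conj_commute)
  qed
  have A: "(\<lambda>\<omega>. restrict (\<lambda>i. N i \<omega>) ?K) -` ?S \<inter> space M = A"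
  proof -
    have "(\<Sum>J\<in>{J\<in>Pow \<F>. p \<in> J}. restrict (\<lambda>i. N i \<omega>) ?K (Inl J)) = point_count (fst p) (X \<omega>)"
      if "p \<in> \<F>" for p \<omega>
      using point_count_eq_sum_atoms[OF F(1) that, of C] F(2) that by (simp add: N_def B_def)
    then show ?thesis unfolding F(3) by (auto simp: space_PiM)
  qed
  have A': "(\<lambda>\<omega>. restrict (\<lambda>i. N i \<omega>) ?K') -` ?S' \<inter> space M = A'"
  proof -
    have "(\<Sum>J\<in>{J\<in>Pow \<F>'. p \<in> J}. restrict (\<lambda>i. N i \<omega>) ?K' (Inr J)) = point_count (fst p) (X \<omega>)"
      if "p \<in> \<F>'" for p \<omega>
      using point_count_eq_sum_atoms[OF F'(1) that, of D] F'(2) that by (simp add: N_def B_def)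
    then show ?thesis unfolding F'(3) by (auto simp: space_PiM)
  qed
  have "prob ((\<lambda>\<omega>. (restrict (\<lambda>i. N i \<omega>) ?K, restrict (\<lambda>i. N i \<omega>) ?K')) -` (?S \<times> ?S') \<inter> space M) =
      prob ((\<lambda>\<omega>. restrict (\<lambda>i. N i \<omega>) ?K) -` ?S \<inter> space M) *
      prob ((\<lambda>\<omega>. restrict (\<lambda>i. N i \<omega>) ?K') -` ?S' \<inter> space M)"
    by (rule indep_varD[OF iv mS mS'])
  moreover have "(\<lambda>\<omega>. (restrict (\<lambda>i. N i \<omega>) ?K, restrict (\<lambda>i. N i \<omega>) ?K')) -` (?S \<times> ?S') \<inter> space M = A \<inter> A'"
    using A A' by blast
  ultimately show "prob (A \<inter> A') = prob A * prob A'" using A A' by simp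
qed

lemma indep_inside:
  assumes "C \<in> sets borel" "D \<in> sets borel" "C \<inter> D = {}"
  shows "indep_set (sets (inside C)) (sets (inside D))"
  unfolding sets_inside
  by (intro indep_set_sigma_sets indep_cylinders assms Int_stable_cylinders)

lemma sets_inside_subset: "sets (inside D) \<subseteq> events"
  unfolding sets_inside by (intro sets.sigma_sets_subset cylinders_events)

lemma measurable_inside_imp: "f \<in> inside D \<rightarrow>\<^sub>M N \<Longrightarrow> f \<in> M \<rightarrow>\<^sub>M N"
  using sets_inside_subset[of D] by (auto simp: measurable_def)

lemma integral_indicator_mult_inside:
  fixes U :: "'w \<Rightarrow> real"
  assumes CD: "C \<in> sets borel" "D \<in> sets borel" "C \<inter> D = {}"
    and E: "E \<in> sets (inside C)" and U: "U \<in> borel_measurable (inside D)" and int: "integrable M U"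
  shows "(\<integral>\<omega>. indicator E \<omega> * U \<omega> \<partial>M) = prob E * (\<integral>\<omega>. U \<omega> \<partial>M)"
proof -
  have Em: "E \<in> events" using E sets_inside_subset by blast
  have mE: "(indicator E :: 'w \<Rightarrow> real) \<in> borel_measurable (inside C)" using E by simp
  have "indep_var borel (indicator E :: 'w \<Rightarrow> real) borel U"
    unfolding indep_var_eq
  proof (intro conjI)
    show "random_variable borel (indicator E :: 'w \<Rightarrow> real)" "random_variable borel U"
      using mE U measurable_inside_imp by auto
    have sub: "sigma_sets (space M) {f -` A \<inter> space M |A. A \<in> sets borel} \<subseteq> sets (inside C')"
      if "f \<in> borel_measurable (inside C')" for C' and f :: "'w \<Rightarrow> real"
    proof -
      have "sigma_sets (space (inside C')) {f -` A \<inter> space M |A. A \<in> sets borel} \<subseteq> sets (inside C')"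
        using measurable_sets[OF that] by (intro sets.sigma_sets_subset) auto
      then show ?thesis by simp
    qed
    show "indep_set (sigma_sets (space M) {(indicator E :: 'w \<Rightarrow> real) -` A \<inter> space M |A. A \<in> sets borel})
        (sigma_sets (space M) {U -` A \<inter> space M |A. A \<in> sets borel})"
      using indep_inside[OF CD] sub[OF mE] sub[OF U] unfolding indep_set_def
      by (elim indep_sets_mono_sets) (auto split: bool.split)
  qed
  then have "(\<integral>\<omega>. indicator E \<omega> * U \<omega> \<partial>M) = (\<integral>\<omega>. indicator E \<omega> \<partial>M) * (\<integral>\<omega>. U \<omega> \<partial>M)"
    using Em int by (intro indep_var_lebesgue_integral integrable_real_indicator) (auto simp: emeasure_eq_measure)
  then show ?thesis using Em by simp
qed

text \<open>The fourth moment is needed because the functionals are bounded by a multiple of the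
  squared number of points and are themselves squared in the variance.\<close>

lemma integrable_card_power: "integrable M (\<lambda>\<omega>. real (card (X \<omega>)) ^ 4)"
proof -
  let ?m = "measure \<mu> UNIV"
  let ?N = "\<lambda>\<omega>. point_count UNIV (X \<omega>)"
  have [measurable]: "(\<lambda>\<omega>. real (card (X \<omega>))) \<in> borel_measurable M"
    unfolding card_eq_point_count by measurable
  have "(\<integral>\<^sup>+\<omega>. ennreal (real (card (X \<omega>)) ^ 4) \<partial>M) =
      (\<integral>\<^sup>+\<omega>. (\<Sum>j. ennreal (real j ^ 4) * indicator {\<omega>\<in>space M. ?N \<omega> = of_nat j} \<omega>) \<partial>M)"
  proof (rule nn_integral_cong_AE)
    show "AE \<omega> in M. ennreal (real (card (X \<omega>)) ^ 4) =
        (\<Sum>j. ennreal (real j ^ 4) * indicator {\<omega>\<in>space M. ?N \<omega> = of_nat j} \<omega>)"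
      using AE_point_count_nat[of UNIV, simplified] AE_space
    proof eventually_elim
      case (elim \<omega>)
      then obtain i where i: "?N \<omega> = of_nat i" by auto
      then have "(\<Sum>j. ennreal (real j ^ 4) * indicator {\<omega>\<in>space M. ?N \<omega> = of_nat j} \<omega>) =
          (\<Sum>j. if j = i then ennreal (real i ^ 4) else 0)"
        using elim(2) by (intro suminf_cong) auto
      also have "\<dots> = ennreal (real i ^ 4)"
        using sums_unique[OF sums_If_finite_set[of "{i}" "\<lambda>_. ennreal (real i ^ 4)"]] by simp
      finally show ?case using i by (auto simp: point_count_eq_iff)
    qed
  qed
  also have "\<dots> = (\<Sum>j. \<integral>\<^sup>+\<omega>. ennreal (real j ^ 4) * indicator {\<omega>\<in>space M. ?N \<omega> = of_nat j} \<omega> \<partial>M)"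
    by (intro nn_integral_suminf) measurable
  also have "\<dots> = (\<Sum>j. ennreal (real j ^ 4 * (exp (- ?m) * ?m ^ j / fact j)))"
  proof (rule suminf_cong)
    fix j :: nat
    show "(\<integral>\<^sup>+\<omega>. ennreal (real j ^ 4) * indicator {\<omega>\<in>space M. ?N \<omega> = of_nat j} \<omega> \<partial>M) =
        ennreal (real j ^ 4 * (exp (- ?m) * ?m ^ j / fact j))"
      using prob_point_count[of UNIV j]
      by (subst nn_integral_cmult_indicator) (simp_all add: emeasure_eq_measure flip: ennreal_mult)
  qed
  also have "\<dots> < \<infinity>"
  proof -
    have "summable (\<lambda>j. real j ^ 4 * (exp (- ?m) * ?m ^ j / fact j))"
    proof (rule summable_comparison_test')
      show "summable (\<lambda>j. 24 * exp (- ?m) * ((exp 1 * ?m) ^ j /\<^sub>R fact j))"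
        by (intro summable_mult summable_exp_generic)
      fix j :: nat
      \<comment> \<open>One term of the exponential series gives
        \<open>j ^ 4 \<le> 24 * exp j\<close>; the factor \<open>exp 1 ^ j\<close> merely changes
        the parameter of the Poisson series.\<close>
      have "real j ^ 4 / fact 4 \<le> (\<Sum>i<5. real j ^ i / fact i)"
        by (rule member_le_sum) auto
      also have "\<dots> \<le> exp (real j)"
        using sum_le_suminf[of "\<lambda>i. real j ^ i /\<^sub>R fact i" "{..<5}"] summable_exp_generic[of "real j"]
        by (simp add: exp_def divide_inverse mult.commute)
      also have "\<dots> = exp 1 ^ j" by (simp flip: exp_of_nat_mult)
      finally have "real j ^ 4 \<le> 24 * exp 1 ^ j" by (simp add: fact_numeral)
      then have "real j ^ 4 * (exp (- ?m) * ?m ^ j / fact j) \<le> 24 * exp 1 ^ j * (exp (- ?m) * ?m ^ j / fact j)"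
        by (intro mult_right_mono) auto
      then show "norm (real j ^ 4 * (exp (- ?m) * ?m ^ j / fact j)) \<le>
          24 * exp (- ?m) * ((exp 1 * ?m) ^ j /\<^sub>R fact j)"
        by (simp add: power_mult_distrib field_simps)
    qed
    then show ?thesis by (subst suminf_ennreal2) auto
  qed
  finally show ?thesis by (intro integrableI_bounded) auto
qed

end

subsection \<open>A variance lower bound and elementary geometry\<close>

text \<open>
  The lower bound is the Cauchy-Schwarz inequality for \<open>H\<close> and the sum of the \<open>Y x\<close>; it is
  obtained from the non-negative second moment of \<open>H - E H - b / K\<^sup>2 * (\<Sum>x\<in>Z. Y x)\<close>.
\<close>
lemma (in prob_space) variance_ge_uncorrelated_test_functions:
  fixes H :: "'a \<Rightarrow> real" and Y :: "'i \<Rightarrow> 'a \<Rightarrow> real"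
  assumes Z: "finite Z" and H: "integrable M H" and H2: "integrable M (\<lambda>\<omega>. (H \<omega>)\<^sup>2)"
    and Y: "\<And>x. x \<in> Z \<Longrightarrow> Y x \<in> borel_measurable M"
    and bound: "\<And>x \<omega>. x \<in> Z \<Longrightarrow> \<bar>Y x \<omega>\<bar> \<le> K"
    and centered: "\<And>x. x \<in> Z \<Longrightarrow> expectation (Y x) = 0"
    and uncorrelated: "\<And>x x'. x \<in> Z \<Longrightarrow> x' \<in> Z \<Longrightarrow> x \<noteq> x' \<Longrightarrow> expectation (\<lambda>\<omega>. Y x \<omega> * Y x' \<omega>) = 0"
    and b: "\<And>x. x \<in> Z \<Longrightarrow> expectation (\<lambda>\<omega>. H \<omega> * Y x \<omega>) \<ge> b" "b \<ge> 0" and K: "K > 0"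
  shows "variance H \<ge> real (card Z) * (b\<^sup>2 / K\<^sup>2)"
proof -
  define S where "S = (\<lambda>\<omega>. \<Sum>x\<in>Z. Y x \<omega>)"
  \<comment> \<open>The minimizer of \<open>l\<^sup>2 * K\<^sup>2 - 2 * l * b\<close>, which, up to
    the factor \<open>card Z\<close>, is the bound to be optimized.\<close>
  define l where "l = b / K\<^sup>2"
  let ?h = "expectation H"
  have Hm: "H \<in> borel_measurable M" using H by (rule borel_measurable_integrable)
  have YY: "integrable M (\<lambda>\<omega>. Y x \<omega> * Y x' \<omega>)" if "x \<in> Z" "x' \<in> Z" for x x'
  proof (rule integrable_const_bound[where B = "K * K"])
    show "AE \<omega> in M. norm (Y x \<omega> * Y x' \<omega>) \<le> K * K"
      using bound that by (intro AE_I2) (simp add: abs_mult mult_mono')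
    show "(\<lambda>\<omega>. Y x \<omega> * Y x' \<omega>) \<in> borel_measurable M"
      using Y that by (intro borel_measurable_times) auto
  qed
  have Yi: "integrable M (Y x)" if "x \<in> Z" for x
    using bound Y that by (intro integrable_const_bound[where B = K]) auto
  have HY: "integrable M (\<lambda>\<omega>. H \<omega> * Y x \<omega>)" if "x \<in> Z" for x
  proof (rule Bochner_Integration.integrable_bound)
    show "integrable M (\<lambda>\<omega>. K * H \<omega>)" using H by simp
    show "(\<lambda>\<omega>. H \<omega> * Y x \<omega>) \<in> borel_measurable M"
      using Hm Y that by (intro borel_measurable_times) auto
    show "AE \<omega> in M. norm (H \<omega> * Y x \<omega>) \<le> norm (K * H \<omega>)"
    proof (rule AE_I2)
      fix \<omega>
      have "\<bar>Y x \<omega>\<bar> * \<bar>H \<omega>\<bar> \<le> K * \<bar>H \<omega>\<bar>" using bound[OF that] by (rule mult_right_mono) simp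
      then show "norm (H \<omega> * Y x \<omega>) \<le> norm (K * H \<omega>)" using K by (simp add: abs_mult mult.commute)
    qed
  qed
  have Sq: "(S \<omega>)\<^sup>2 = (\<Sum>x\<in>Z. \<Sum>x'\<in>Z. Y x \<omega> * Y x' \<omega>)" for \<omega>
    by (simp add: S_def power2_eq_square sum_product)
  have iS2: "integrable M (\<lambda>\<omega>. (S \<omega>)\<^sup>2)"
    unfolding Sq using YY by (intro Bochner_Integration.integrable_sum) auto
  have iHS: "integrable M (\<lambda>\<omega>. H \<omega> * S \<omega>)"
    unfolding S_def sum_distrib_left using HY by (intro Bochner_Integration.integrable_sum) auto
  have iS: "integrable M S"
    unfolding S_def using Yi by (intro Bochner_Integration.integrable_sum) auto
  have ES: "expectation S = 0"
    unfolding S_def using Yi centered by (simp add: Bochner_Integration.integral_sum)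
  have EHS: "real (card Z) * b \<le> expectation (\<lambda>\<omega>. H \<omega> * S \<omega>)"
  proof -
    have "real (card Z) * b = (\<Sum>x\<in>Z. b)" by simp
    also have "\<dots> \<le> (\<Sum>x\<in>Z. expectation (\<lambda>\<omega>. H \<omega> * Y x \<omega>))" by (intro sum_mono b)
    also have "\<dots> = expectation (\<lambda>\<omega>. H \<omega> * S \<omega>)"
      unfolding S_def sum_distrib_left using HY by (intro Bochner_Integration.integral_sum[symmetric]) auto
    finally show ?thesis .
  qed
  have ES2: "expectation (\<lambda>\<omega>. (S \<omega>)\<^sup>2) \<le> real (card Z) * K\<^sup>2"
  proof -
    have "expectation (\<lambda>\<omega>. (S \<omega>)\<^sup>2) = (\<Sum>x\<in>Z. \<Sum>x'\<in>Z. expectation (\<lambda>\<omega>. Y x \<omega> * Y x' \<omega>))"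
      unfolding Sq using YY by (simp add: Bochner_Integration.integral_sum)
    also have "\<dots> = (\<Sum>x\<in>Z. \<Sum>x'\<in>Z. if x' = x then expectation (\<lambda>\<omega>. Y x \<omega> * Y x \<omega>) else 0)"
      using uncorrelated by (intro sum.cong refl) auto
    also have "\<dots> = (\<Sum>x\<in>Z. expectation (\<lambda>\<omega>. Y x \<omega> * Y x \<omega>))"
      using Z by (simp add: sum.delta)
    also have "\<dots> \<le> (\<Sum>x\<in>Z. K\<^sup>2)"
    proof (rule sum_mono)
      fix x assume x: "x \<in> Z"
      have "expectation (\<lambda>\<omega>. Y x \<omega> * Y x \<omega>) \<le> expectation (\<lambda>\<omega>. K\<^sup>2)"
      proof (rule integral_mono[OF YY[OF x x]])
        fix \<omega>
        show "Y x \<omega> * Y x \<omega> \<le> K\<^sup>2"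
          using power_mono[OF bound[OF x, of \<omega>], of 2] by (simp add: power2_eq_square)
      qed simp
      then show "expectation (\<lambda>\<omega>. Y x \<omega> * Y x \<omega>) \<le> K\<^sup>2" by (simp add: prob_space)
    qed
    finally show ?thesis by simp
  qed
  have iV: "integrable M (\<lambda>\<omega>. (H \<omega> - ?h)\<^sup>2)"
    using H H2 by (simp add: power2_diff)
  have "0 \<le> expectation (\<lambda>\<omega>. (H \<omega> - ?h - l * S \<omega>)\<^sup>2)"
    by (rule integral_nonneg_AE) simp
  also have "(\<lambda>\<omega>. (H \<omega> - ?h - l * S \<omega>)\<^sup>2) =
      (\<lambda>\<omega>. (H \<omega> - ?h)\<^sup>2 - 2 * l * (H \<omega> * S \<omega>) + 2 * l * ?h * S \<omega> + l\<^sup>2 * (S \<omega>)\<^sup>2)"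
    by (simp add: fun_eq_iff power2_eq_square algebra_simps)
  also have "expectation \<dots> = variance H - 2 * l * expectation (\<lambda>\<omega>. H \<omega> * S \<omega>) + 2 * l * ?h * expectation S
      + l\<^sup>2 * expectation (\<lambda>\<omega>. (S \<omega>)\<^sup>2)"
    using iV iHS iS iS2 by simp
  also have "\<dots> \<le> variance H - 2 * l * (real (card Z) * b) + l\<^sup>2 * (real (card Z) * K\<^sup>2)"
  proof -
    have "l \<ge> 0" using b(2) by (simp add: l_def)
    then have "2 * l * (real (card Z) * b) \<le> 2 * l * expectation (\<lambda>\<omega>. H \<omega> * S \<omega>)"
      using EHS by (intro mult_left_mono) auto
    moreover have "l\<^sup>2 * expectation (\<lambda>\<omega>. (S \<omega>)\<^sup>2) \<le> l\<^sup>2 * (real (card Z) * K\<^sup>2)"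
      using ES2 by (rule mult_left_mono) simp
    ultimately show ?thesis using ES by simp
  qed
  also have "l\<^sup>2 * (real (card Z) * K\<^sup>2) = l * (real (card Z) * b)"
    using K by (simp add: l_def power2_eq_square)
  finally have "real (card Z) * (l * b) \<le> variance H" by (simp add: mult_ac)
  then show ?thesis by (simp add: l_def power2_eq_square)
qed

text \<open>Let \<open>m\<close> have the smallest exponent among the indices with non-zero
  coefficient. Dividing by \<open>\<tau> powr q m\<close> leaves \<open>\<alpha> m\<close> plus
  terms with positive exponents, by injectivity of \<open>q\<close>; near 0 these use up at most
  half of \<open>\<alpha> m\<close>, whose sign is \<open>\<sigma>\<close>.\<close>

lemma generalized_polynomial_sign_near_0:
  fixes q \<alpha> :: "'i \<Rightarrow> real"
  assumes I: "finite I" and inj: "inj_on q I" and nz: "\<exists>i\<in>I. \<alpha> i \<noteq> 0"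
  obtains \<sigma> m a r where "m \<in> I" "\<bar>\<sigma>\<bar> = 1" "a > 0" "r > 0"
    "\<And>\<tau>. 0 < \<tau> \<Longrightarrow> \<tau> \<le> r \<Longrightarrow> a * \<tau> powr q m \<le> \<sigma> * (\<Sum>i\<in>I. \<alpha> i * \<tau> powr q i)"
proof -
  define J where "J = {i\<in>I. \<alpha> i \<noteq> 0}"
  have J: "finite J" "J \<noteq> {}" using I nz by (auto simp: J_def)
  define m where "m = arg_min_on q J"
  have m: "m \<in> J" "\<And>i. i \<in> J \<Longrightarrow> q m \<le> q i"
    unfolding m_def using arg_min_if_finite[OF J, of q] J by (auto intro: arg_min_least)
  then have mI: "m \<in> I" and m0: "\<alpha> m \<noteq> 0" by (auto simp: J_def)
  have lim: "((\<lambda>\<tau>. \<Sum>i\<in>J - {m}. \<alpha> i * \<tau> powr (q i - q m)) \<longlongrightarrow> (\<Sum>i\<in>J - {m}. \<alpha> i * 0)) (at_right 0)"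
  proof (intro tendsto_sum tendsto_mult tendsto_const)
    fix i assume i: "i \<in> J - {m}"
    then have "q i \<noteq> q m" using inj mI by (auto simp: J_def inj_on_def)
    then have "q i - q m > 0" using m(2)[of i] i by simp
    then show "((\<lambda>\<tau>. \<tau> powr (q i - q m)) \<longlongrightarrow> 0) (at_right 0)"
      by (intro tendsto_zero_powrI[where b = "q i - q m"]) (auto intro!: tendsto_ident_at eventually_at_right_less[THEN eventually_mono])
  qed
  then have "\<forall>\<^sub>F \<tau> in at_right 0. \<bar>\<Sum>i\<in>J - {m}. \<alpha> i * \<tau> powr (q i - q m)\<bar> < \<bar>\<alpha> m\<bar> / 2"
    using m0 tendstoD[OF lim, of "\<bar>\<alpha> m\<bar> / 2"] by (simp add: dist_real_def)
  then obtain r where r: "r > 0"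
    "\<And>\<tau>. 0 < \<tau> \<Longrightarrow> \<tau> < r \<Longrightarrow> \<bar>\<Sum>i\<in>J - {m}. \<alpha> i * \<tau> powr (q i - q m)\<bar> < \<bar>\<alpha> m\<bar> / 2"
    unfolding eventually_at_right_field by blast
  show thesis
  \<comment> \<open>The bound on the remainder holds strictly below the old \<open>r\<close>;
    halving it admits the endpoint.\<close>
  proof (rule that[of m "sgn (\<alpha> m)" "\<bar>\<alpha> m\<bar> / 2" "r / 2"])
    show "m \<in> I" by fact
    show "\<bar>sgn (\<alpha> m)\<bar> = 1" "\<bar>\<alpha> m\<bar> / 2 > 0" "r / 2 > 0" using m0 r(1) by (auto simp: abs_sgn_eq)
    fix \<tau> :: real assume \<tau>: "0 < \<tau>" "\<tau> \<le> r / 2"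
    let ?R = "\<Sum>i\<in>J - {m}. \<alpha> i * \<tau> powr (q i - q m)"
    have "(\<Sum>i\<in>I. \<alpha> i * \<tau> powr q i) = (\<Sum>i\<in>J. \<alpha> i * \<tau> powr q i)"
      using I by (intro sum.mono_neutral_right) (auto simp: J_def)
    also have "\<dots> = \<alpha> m * \<tau> powr q m + (\<Sum>i\<in>J - {m}. \<alpha> i * \<tau> powr q i)"
      by (rule sum.remove[OF J(1) m(1)])
    also have "(\<Sum>i\<in>J - {m}. \<alpha> i * \<tau> powr q i) = ?R * \<tau> powr q m"
      unfolding sum_distrib_right using \<tau> by (intro sum.cong refl) (simp add: powr_diff)
    finally have eq: "(\<Sum>i\<in>I. \<alpha> i * \<tau> powr q i) = (\<alpha> m + ?R) * \<tau> powr q m"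
      by (simp add: algebra_simps)
    have "\<bar>?R\<bar> < \<bar>\<alpha> m\<bar> / 2" using \<tau> r by (intro r(2)) auto
    then have "\<bar>\<alpha> m\<bar> / 2 \<le> sgn (\<alpha> m) * (\<alpha> m + ?R)"
      using m0 by (auto simp: sgn_if abs_if split: if_splits)
    then have "\<bar>\<alpha> m\<bar> / 2 * \<tau> powr q m \<le> sgn (\<alpha> m) * (\<alpha> m + ?R) * \<tau> powr q m"
      by (rule mult_right_mono) simp
    then show "\<bar>\<alpha> m\<bar> / 2 * \<tau> powr q m \<le> sgn (\<alpha> m) * (\<Sum>i\<in>I. \<alpha> i * \<tau> powr q i)"
      unfolding eq by (simp add: mult_ac)
  qed
qed

section \<open>Balls, grids and nets in Euclidean space\<close>

lemma convex_positive_measure_contains_ball: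
  fixes W :: "'a::euclidean_space set"
  assumes "compact W" "convex W" "emeasure lborel W > 0"
  obtains w \<rho> where "\<rho> > 0" "ball w \<rho> \<subseteq> W"
proof -
  have "interior W \<noteq> {}"
  proof
    assume "interior W = {}"
    then have "negligible W" using negligible_convex_interior[OF assms(2)] by simp
    then have "emeasure lebesgue W = 0"
      by (simp add: negligible_iff_null_sets null_sets_def)
    moreover have "W \<in> sets lborel" using assms(1) by (simp add: borel_compact)
    ultimately show False using assms(3) by simp
  qed
  then obtain w where "w \<in> interior W" by blast
  then show thesis using that unfolding mem_interior by blast
qed

text \<open>The points form a cubic grid of mesh \<open>4 * t\<close> with corner \<open>w\<close>:
  different multi-indices differ by at least 1 in some coordinate, and a coordinate is bounded by
  the norm.\<close>

lemma separated_points_in_ball: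
  fixes w :: "'a::euclidean_space" and \<rho> t :: real
  assumes \<rho>: "\<rho> > 0" and t: "0 < t" "t \<le> \<rho> / (16 * real DIM('a))"
  obtains Z where "finite Z" "real (card Z) \<ge> (\<rho> / (16 * real DIM('a) * t)) ^ DIM('a)"
    "\<And>x. x \<in> Z \<Longrightarrow> ball x (2 * t) \<subseteq> ball w \<rho>"
    "\<And>x x'. x \<in> Z \<Longrightarrow> x' \<in> Z \<Longrightarrow> x \<noteq> x' \<Longrightarrow> 4 * t \<le> dist x x'"
proof -
  let ?d = "real DIM('a)"
  have d: "?d \<ge> 1" using DIM_positive[where 'a='a] by linarith
  \<comment> \<open>A grid point is at most \<open>DIM('a) * 4 * t * m\<close> away from
    \<open>w\<close>; this choice keeps it within \<open>\<rho> / 2\<close> and leaves room for the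
    ball of radius \<open>2 * t\<close>. Rounding down costs at most a factor 2, because
    \<open>\<rho> / (16 * DIM('a) * t) \<ge> 1\<close>: hence 16 in the conclusion in place of
    8.\<close>
  define m where "m = nat \<lfloor>\<rho> / (8 * ?d * t)\<rfloor>"
  have a: "\<rho> / (16 * ?d * t) \<ge> 1" using t d by (simp add: field_simps)
  have m_le: "real m \<le> \<rho> / (8 * ?d * t)" using \<rho> t d by (simp add: m_def)
  have m_ge: "real m \<ge> \<rho> / (16 * ?d * t)"
  proof -
    have "real m > \<rho> / (8 * ?d * t) - 1" using \<rho> t d by (simp add: m_def)
    moreover have "\<rho> / (8 * ?d * t) = \<rho> / (16 * ?d * t) + \<rho> / (16 * ?d * t)" by (simp add: field_simps)
    ultimately show ?thesis using a by linarith
  qed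
  define \<F> where "\<F> = PiE (Basis :: 'a set) (\<lambda>_. {..<m})"
  define g where "g = (\<lambda>f. w + (\<Sum>b\<in>Basis. (4 * t * real (f b)) *\<^sub>R (b :: 'a)))"
  have inner: "g f \<bullet> b = w \<bullet> b + 4 * t * real (f b)" if "b \<in> Basis" for f b
    using that by (simp add: g_def inner_add_left inner_sum_left_Basis)
  have sep: "4 * t \<le> dist (g f) (g f')" if "f \<in> \<F>" "f' \<in> \<F>" "f \<noteq> f'" for f f'
  proof -
    have "\<exists>b\<in>Basis. f b \<noteq> f' b"
    proof (rule ccontr)
      assume "\<not> (\<exists>b\<in>Basis. f b \<noteq> f' b)"
      then have "f b = f' b" if "b \<in> Basis" for b using that by blast
      then have "f = f'" by (rule PiE_ext[OF that(1,2)[unfolded \<F>_def]])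
      then show False using that(3) by simp
    qed
    then obtain b where b: "b \<in> Basis" "f b \<noteq> f' b" by blast
    then have "1 \<le> \<bar>real (f b) - real (f' b)\<bar>" by linarith
    then have "4 * t * 1 \<le> 4 * t * \<bar>real (f b) - real (f' b)\<bar>" using t by (intro mult_left_mono) auto
    also have "\<dots> = \<bar>4 * t * (real (f b) - real (f' b))\<bar>" using t by (simp add: abs_mult)
    also have "4 * t * (real (f b) - real (f' b)) = (g f - g f') \<bullet> b"
      unfolding inner_diff_left inner[OF b(1)] by (simp only: right_diff_distrib add_diff_cancel_left)
    also have "\<bar>(g f - g f') \<bullet> b\<bar> \<le> norm (g f - g f')" using b(1) by (rule Basis_le_norm)
    finally show ?thesis by (simp add: dist_norm)
  qed
  have "inj_on g \<F>"
  proof (rule inj_onI, rule ccontr)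
    fix f f' assume "f \<in> \<F>" "f' \<in> \<F>" "g f = g f'" "f \<noteq> f'"
    then show False using sep[of f f'] t by simp
  qed
  then have card: "card (g ` \<F>) = m ^ DIM('a)"
    by (simp add: card_image \<F>_def card_PiE)
  show thesis
  proof (rule that[of "g ` \<F>"])
    show "finite (g ` \<F>)" by (simp add: \<F>_def finite_PiE)
    show "real (card (g ` \<F>)) \<ge> (\<rho> / (16 * ?d * t)) ^ DIM('a)"
      unfolding card of_nat_power using m_ge a by (intro power_mono) auto
    show "4 * t \<le> dist x x'" if "x \<in> g ` \<F>" "x' \<in> g ` \<F>" "x \<noteq> x'" for x x'
      using that sep by blast
    fix x assume "x \<in> g ` \<F>"
    then obtain f where f: "f \<in> \<F>" "x = g f" by blast
    have "norm (x - w) \<le> (\<Sum>b\<in>(Basis :: 'a set). norm ((4 * t * real (f b)) *\<^sub>R b))"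
      unfolding f(2) g_def add_diff_cancel_left' by (rule norm_sum)
    also have "\<dots> = (\<Sum>b\<in>(Basis :: 'a set). 4 * t * real (f b))" using t by simp
    also have "\<dots> \<le> (\<Sum>b\<in>(Basis :: 'a set). 4 * t * real m)"
      using f t by (intro sum_mono mult_left_mono) (auto simp: \<F>_def PiE_iff less_imp_le)
    also have "\<dots> = ?d * (4 * t * real m)" by simp
    also have "\<dots> \<le> ?d * (4 * t * (\<rho> / (8 * ?d * t)))"
      using t m_le by (intro mult_left_mono) auto
    also have "\<dots> = \<rho> / 2" using t d by simp
    finally have x: "norm (x - w) \<le> \<rho> / 2" .
    have "16 * ?d * t \<le> \<rho>" using t(2) d by (simp add: field_simps)
    moreover have "16 * 1 * t \<le> 16 * ?d * t" using d t by (intro mult_right_mono) auto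
    ultimately have "2 * t \<le> \<rho> / 2" using t by linarith
    then show "ball x (2 * t) \<subseteq> ball w \<rho>"
      using x by (intro ball_subset_ball_iff[THEN iffD2]) (simp add: dist_norm)
  qed
qed

text \<open>Total boundedness of the sphere yields the net. Its finitely many points have a positive
  minimal distance, and \<open>\<delta>\<close> is taken from it so that the clusters around them
  are disjoint.\<close>

lemma unit_sphere_net:
  obtains P :: "'a::euclidean_space set" and \<delta> :: real
  where "finite P" "P \<noteq> {}" "\<And>p. p \<in> P \<Longrightarrow> norm p = 1"
    "\<And>u. norm u = 1 \<Longrightarrow> \<exists>p\<in>P. norm (u - p) \<le> 1 / 8"
    "0 < \<delta>" "\<delta> \<le> 1 / 8" "\<And>p p'. p \<in> P \<Longrightarrow> p' \<in> P \<Longrightarrow> p \<noteq> p' \<Longrightarrow> 2 * \<delta> < norm (p - p')"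
proof -
  have "compact (sphere (0::'a) 1)" by simp
  then obtain P where P: "finite P" "P \<subseteq> sphere (0::'a) 1" "sphere 0 1 \<subseteq> (\<Union>x\<in>P. ball x (1 / 8))"
    using seq_compact_imp_totally_bounded[OF compact_imp_seq_compact, of "sphere (0::'a) 1"]
    by (meson zero_less_divide_1_iff zero_less_numeral)
  \<comment> \<open>The element \<open>3 / 8\<close> makes \<open>D\<close> nonempty and ensures
    \<open>Min D / 3 \<le> 1 / 8\<close>; a third of the minimum instead of a half makes the
    separation strict.\<close>
  define D where "D = insert (3 / 8) ((\<lambda>(p, p'). norm (p - p')) ` {pp\<in>P \<times> P. fst pp \<noteq> snd pp})"
  have D: "finite D" "D \<noteq> {}" using P(1) by (auto simp: D_def)
  have Dpos: "x > 0" if "x \<in> D" for x using that by (auto simp: D_def)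
  obtain e :: 'a where e: "norm e = 1" using norm_Basis nonempty_Basis by blast
  show thesis
  proof (rule that[of P "Min D / 3"])
    show "P \<noteq> {}" using P(3) e by auto
    show "norm p = 1" if "p \<in> P" for p using P(2) that by auto
    show "\<exists>p\<in>P. norm (u - p) \<le> 1 / 8" if "norm u = 1" for u
    proof -
      have "u \<in> sphere 0 1" using that by simp
      then obtain p where "p \<in> P" "dist p u < 1 / 8" using P(3) by auto
      then show ?thesis by (intro bexI[of _ p]) (auto simp: dist_norm norm_minus_commute)
    qed
    have min: "Min D > 0" using Dpos Min_in[OF D] by blast
    then show "0 < Min D / 3" by simp
    have "Min D \<le> 3 / 8" using D by (intro Min_le) (auto simp: D_def)
    then show "Min D / 3 \<le> 1 / 8" by simp
    show "2 * (Min D / 3) < norm (p - p')" if "p \<in> P" "p' \<in> P" "p \<noteq> p'" for p p'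
    proof -
      have "norm (p - p') \<in> D" using that by (force simp: D_def)
      then have "Min D \<le> norm (p - p')" using D by simp
      then show ?thesis using min by linarith
    qed
  qed (use P in auto)
qed

subsection \<open>Weighted sums of edge length functionals\<close>

text \<open>The functional \<open>H\<close> of the overview, as a function of a point set, so that
  it can also be evaluated after the core has been deleted.\<close>

definition scaled_edge_length ::
  "nat \<Rightarrow> real \<Rightarrow> 'i set \<Rightarrow> ('i \<Rightarrow> real) \<Rightarrow> ('i \<Rightarrow> real) \<Rightarrow> 'a::euclidean_space set \<Rightarrow> real" where
  "scaled_edge_length k s I \<alpha> q A =
     (\<Sum>i\<in>I. \<alpha> i * (s powr (q i / DIM('a)) * edge_length k (q i) A))"

lemma powr_scaled_distance:
  fixes s x q d :: real
  assumes "s > 0" and "x \<ge> 0"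
  shows "s powr (q / d) * x powr q = (s powr (1 / d) * x) powr q"
  using assms by (simp add: powr_mult powr_powr)

text \<open>By \<open>edge_length_isolated_core\<close>, the difference is a sum over the edges of
  the core. In terms of the scaled length
  \<open>\<tau> = s powr (1 / DIM('a)) * norm (y - z)\<close> every edge contributes through the
  same function of \<open>\<tau>\<close>. The core has diameter below \<open>t\<close>, so
  \<open>\<tau> \<le> r\<close> and no contribution has the wrong sign. One ordered pair between the
  two balls has \<open>\<tau> \<ge> r / 8\<close>; the factor 1/2 is that of
  \<open>edge_length\<close>.\<close>

lemma scaled_edge_length_gain:
  fixes A P :: "'a::euclidean_space set" and x e :: 'a and \<delta> t :: real
  defines "C1 \<equiv> ball (x + (t / 8) *\<^sub>R e) (t / 16)" and "C2 \<equiv> ball (x - (t / 8) *\<^sub>R e) (t / 16)"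
  assumes s: "s > 0" and t: "t > 0" and st: "s powr (1 / DIM('a)) * t = r" and e: "norm e = 1"
    and k: "k \<ge> 1"
    and sgn: "\<And>\<tau>. 0 < \<tau> \<Longrightarrow> \<tau> \<le> r \<Longrightarrow> a * \<tau> powr p0 \<le> \<sigma> * (\<Sum>i\<in>I. \<alpha> i * \<tau> powr q i)"
    and a: "a > 0" and p0: "p0 \<ge> 0"
    and fin: "finite A" and C1: "card (A \<inter> C1) = 1" and C2: "card (A \<inter> C2) = k"
    and shell: "A \<inter> (ball x (3 * t / 4) - (C1 \<union> C2)) = {}"
    and net: "\<And>u. norm u = 1 \<Longrightarrow> \<exists>p\<in>P. norm (u - p) \<le> 1 / 8"
    and P: "\<And>p. p \<in> P \<Longrightarrow> norm p = 1" and \<delta>: "0 < \<delta>" "\<delta> \<le> 1 / 8"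
    and clusters: "\<And>p. p \<in> P \<Longrightarrow> card (A \<inter> cball (x + t *\<^sub>R p) (t * \<delta>)) = k + 2"
  shows "a * (r / 8) powr p0 / 2 \<le>
    \<sigma> * (scaled_edge_length k s I \<alpha> q A - scaled_edge_length k s I \<alpha> q (A - (C1 \<union> C2)))"
proof -
  let ?C = "C1 \<union> C2" and ?c = "s powr (1 / DIM('a))"
  let ?f = "\<lambda>\<tau>. \<Sum>i\<in>I. \<alpha> i * \<tau> powr q i"
  let ?Q = "{(y, z). y \<in> A \<inter> ?C \<and> z \<in> A \<inter> ?C \<and> y \<noteq> z}"
  have r: "r > 0" using s t st by auto
  have ne: "norm ((t / 8) *\<^sub>R e) = t / 8" using t e by simp
  have near1: "norm (y - x - (t / 8) *\<^sub>R e) < t / 16" if "y \<in> C1" for y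
    using that by (simp add: C1_def dist_norm norm_minus_commute algebra_simps)
  have near2: "norm (y - x + (t / 8) *\<^sub>R e) < t / 16" if "y \<in> C2" for y
    using that by (simp add: C2_def dist_norm norm_minus_commute algebra_simps)
  have in_C: "norm (y - x) < 3 * t / 16" if "y \<in> ?C" for y
    using that
  proof
    assume "y \<in> C1"
    then show ?thesis
      using near1[of y] ne norm_triangle_ineq[of "y - x - (t / 8) *\<^sub>R e" "(t / 8) *\<^sub>R e"] by simp
  next
    assume "y \<in> C2"
    then show ?thesis
      using near2[of y] ne norm_triangle_ineq4[of "y - x + (t / 8) *\<^sub>R e" "(t / 8) *\<^sub>R e"] by simp
  qed
  \<comment> \<open>The centres are \<open>t / 4\<close> apart, and the two radii take away
    \<open>t / 16\<close> each.\<close>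
  have sep: "t / 8 \<le> norm (y - z)" if "y \<in> C1" "z \<in> C2" for y z
  proof -
    have "norm ((t / 4) *\<^sub>R e) = t / 4" using t e by simp
    moreover have "(t / 4) *\<^sub>R e = (y - z) - ((y - x - (t / 8) *\<^sub>R e) - (z - x + (t / 8) *\<^sub>R e))"
      by (simp add: algebra_simps flip: scaleR_add_left)
    ultimately have "t / 4 \<le> norm (y - z) + norm ((y - x - (t / 8) *\<^sub>R e) - (z - x + (t / 8) *\<^sub>R e))"
      by (metis norm_triangle_ineq4)
    also have "\<dots> \<le> norm (y - z) + (norm (y - x - (t / 8) *\<^sub>R e) + norm (z - x + (t / 8) *\<^sub>R e))"
      using norm_triangle_ineq4 by (rule add_left_mono)
    finally show ?thesis using near1[OF that(1)] near2[OF that(2)] by simp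
  qed
  have disj: "C1 \<inter> C2 = {}"
  proof (rule ccontr)
    assume "C1 \<inter> C2 \<noteq> {}"
    then obtain y where "y \<in> C1" "y \<in> C2" by blast
    then show False using sep[of y y] t by simp
  qed
  have card: "card (A \<inter> ?C) = k + 1"
    using C1 C2 fin disj by (simp add: Int_Un_distrib card_Un_disjoint Int_ac inf_left_commute)
  have C_ball: "?C \<subseteq> ball x (3 * t / 16)"
    using in_C by (auto simp: dist_norm norm_minus_commute)
  have finQ: "finite ?Q" by (rule finite_subset[of _ "A \<times> A"]) (use fin in auto)
  have range: "0 < ?c * norm (y - z)" "?c * norm (y - z) \<le> r" if "(y, z) \<in> ?Q" for y z
  proof -
    show "0 < ?c * norm (y - z)" using that s by simp
    have "norm (y - z) \<le> norm (y - x) + norm (z - x)"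
      using norm_triangle_ineq4[of "y - x" "z - x"] by simp
    also have "\<dots> \<le> t" using in_C[of y] in_C[of z] that t by simp
    finally have "?c * norm (y - z) \<le> ?c * t" by (rule mult_left_mono) simp
    then show "?c * norm (y - z) \<le> r" using st by simp
  qed
  have "scaled_edge_length k s I \<alpha> q A - scaled_edge_length k s I \<alpha> q (A - ?C) =
      (\<Sum>i\<in>I. \<alpha> i * (s powr (q i / DIM('a)) * (1 / 2 * (\<Sum>(y, z)\<in>?Q. norm (y - z) powr q i))))"
    unfolding scaled_edge_length_def sum_subtractf[symmetric]
    using edge_length_isolated_core[OF fin t card C_ball shell net P \<delta> clusters]
    by (intro sum.cong refl) (simp add: algebra_simps)
  also have "\<dots> = (\<Sum>i\<in>I. \<Sum>(y, z)\<in>?Q. 1 / 2 * (\<alpha> i * (?c * norm (y - z)) powr q i))"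
  proof (intro sum.cong refl)
    fix i
    have "\<alpha> i * (s powr (q i / DIM('a)) * (1 / 2 * (\<Sum>(y, z)\<in>?Q. norm (y - z) powr q i))) =
        (\<Sum>(y, z)\<in>?Q. 1 / 2 * (\<alpha> i * (s powr (q i / DIM('a)) * norm (y - z) powr q i)))"
      unfolding sum_distrib_left by (intro sum.cong refl) (simp add: case_prod_beta)
    then show "\<alpha> i * (s powr (q i / DIM('a)) * (1 / 2 * (\<Sum>(y, z)\<in>?Q. norm (y - z) powr q i))) =
        (\<Sum>(y, z)\<in>?Q. 1 / 2 * (\<alpha> i * (?c * norm (y - z)) powr q i))"
      by (simp only: powr_scaled_distance[OF s norm_ge_zero])
  qed
  also have "\<dots> = (\<Sum>(y, z)\<in>?Q. 1 / 2 * ?f (?c * norm (y - z)))"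
    unfolding case_prod_beta sum_distrib_left by (rule sum.swap)
  finally have "\<sigma> * (scaled_edge_length k s I \<alpha> q A - scaled_edge_length k s I \<alpha> q (A - ?C)) =
      (\<Sum>(y, z)\<in>?Q. 1 / 2 * (\<sigma> * ?f (?c * norm (y - z))))"
    by (simp add: sum_distrib_left case_prod_beta mult_ac)
  moreover have "a * (r / 8) powr p0 / 2 \<le> (\<Sum>(y, z)\<in>?Q. 1 / 2 * (\<sigma> * ?f (?c * norm (y - z))))"
  proof -
    \<comment> \<open>\<open>k \<ge> 1\<close> enters here: both balls of the core contain a point,
      so there is an edge from one to the other.\<close>
    have "A \<inter> C1 \<noteq> {}" "A \<inter> C2 \<noteq> {}" using C1 C2 k by (metis card.empty zero_neq_one, metis card.empty not_one_le_zero)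
    then obtain y z where y: "y \<in> A \<inter> C1" and z: "z \<in> A \<inter> C2" by blast
    have Q: "(y, z) \<in> ?Q" using y z disj by auto
    have "r / 8 = ?c * (t / 8)" using st by simp
    also have "\<dots> \<le> ?c * norm (y - z)" using sep[of y z] y z by (intro mult_left_mono) auto
    finally have "(r / 8) powr p0 \<le> (?c * norm (y - z)) powr p0"
      using r p0 by (intro powr_mono2) auto
    then have "a * (r / 8) powr p0 \<le> a * (?c * norm (y - z)) powr p0" using a by simp
    also have "\<dots> \<le> \<sigma> * ?f (?c * norm (y - z))" using range[OF Q] by (rule sgn)
    finally have "a * (r / 8) powr p0 / 2 \<le> (\<lambda>(y, z). 1 / 2 * (\<sigma> * ?f (?c * norm (y - z)))) (y, z)"
      by simp
    also have "\<dots> \<le> (\<Sum>(y, z)\<in>?Q. 1 / 2 * (\<sigma> * ?f (?c * norm (y - z))))"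
    proof (rule member_le_sum[OF Q _ finQ])
      fix p assume "p \<in> ?Q - {(y, z)}"
      then obtain y' z' where p: "p = (y', z')" "(y', z') \<in> ?Q" by (cases p) blast
      have "0 \<le> a * (?c * norm (y' - z')) powr p0" using a by simp
      also have "\<dots> \<le> \<sigma> * ?f (?c * norm (y' - z'))" using range[OF p(2)] by (rule sgn)
      finally show "0 \<le> (case p of (y, z) \<Rightarrow> 1 / 2 * (\<sigma> * ?f (?c * norm (y - z))))"
        by (simp add: p(1))
    qed
    finally show ?thesis .
  qed
  ultimately show ?thesis by simp
qed

section \<open>Integrability of the weighted sum\<close>

lemma edge_length_nonneg: "0 \<le> edge_length k q A"
  unfolding edge_length_def by (intro mult_nonneg_nonneg sum_nonneg) auto

lemma edge_length_le:
  fixes A :: "'a::real_normed_vector set"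
  assumes fin: "finite A" and R: "\<And>y z. y \<in> A \<Longrightarrow> z \<in> A \<Longrightarrow> norm (y - z) \<le> R" and q: "q \<ge> 0"
  shows "edge_length k q A \<le> R powr q * (real (card A))\<^sup>2"
proof -
  let ?Q = "{(y, z). y \<in> A \<and> z \<in> A \<and> y \<noteq> z}"
  have sub: "?Q \<subseteq> A \<times> A" by auto
  have "(\<Sum>(y, z)\<in>?Q. of_bool (knn_adjacent k A y z) * norm (y - z) powr q) \<le> (\<Sum>(y, z)\<in>?Q. R powr q)"
  proof (rule sum_mono)
    fix p assume "p \<in> ?Q"
    then obtain y z where p: "p = (y, z)" "y \<in> A" "z \<in> A" by auto
    have "norm (y - z) powr q \<le> R powr q" using R p q by (intro powr_mono2) auto
    then show "(case p of (y, z) \<Rightarrow> of_bool (knn_adjacent k A y z) * norm (y - z) powr q) \<le>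
        (case p of (y, z) \<Rightarrow> R powr q)"
      by (simp add: p(1))
  qed
  also have "\<dots> = R powr q * real (card ?Q)" by simp
  also have "\<dots> \<le> R powr q * real (card (A \<times> A))"
    using card_mono[OF finite_cartesian_product[OF fin fin] sub] by (intro mult_left_mono) auto
  finally have "(\<Sum>(y, z)\<in>?Q. of_bool (knn_adjacent k A y z) * norm (y - z) powr q) \<le> R powr q * (real (card A))\<^sup>2"
    by (simp add: card_cartesian_product power2_eq_square)
  moreover have "0 \<le> R powr q * (real (card A))\<^sup>2" by simp
  ultimately show ?thesis unfolding edge_length_def by linarith
qed

text \<open>Serves integrability at a fixed \<open>s\<close> only: \<open>b\<close> may depend on
  \<open>s\<close>, so counting all pairs and bounding each edge by the diameter of \<open>V\<close>
  is good enough.\<close>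

lemma scaled_edge_length_bound:
  fixes A V :: "'a::euclidean_space set"
  assumes I: "finite I" and q: "\<And>i. i \<in> I \<Longrightarrow> q i \<ge> 0" and V: "bounded V"
  shows "\<exists>b\<ge>0. \<forall>A. finite A \<longrightarrow> A \<subseteq> V \<longrightarrow>
    \<bar>scaled_edge_length k s I \<alpha> q A\<bar> \<le> b * (real (card A))\<^sup>2"
proof -
  obtain R where R: "\<And>y z. y \<in> V \<Longrightarrow> z \<in> V \<Longrightarrow> norm (y - z) \<le> R"
    using V unfolding bounded_two_points dist_norm by metis
  let ?b = "\<Sum>i\<in>I. \<bar>\<alpha> i\<bar> * (s powr (q i / DIM('a)) * R powr q i)"
  show ?thesis
  proof (intro exI[of _ ?b] conjI allI impI)
    show "?b \<ge> 0" by (intro sum_nonneg) auto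
    fix A :: "'a set" assume A: "finite A" "A \<subseteq> V"
    have "\<bar>scaled_edge_length k s I \<alpha> q A\<bar> \<le>
        (\<Sum>i\<in>I. \<bar>\<alpha> i * (s powr (q i / DIM('a)) * edge_length k (q i) A)\<bar>)"
      unfolding scaled_edge_length_def by (rule sum_abs)
    also have "\<dots> \<le> (\<Sum>i\<in>I. \<bar>\<alpha> i\<bar> * (s powr (q i / DIM('a)) * R powr q i) * (real (card A))\<^sup>2)"
    proof (rule sum_mono)
      fix i assume i: "i \<in> I"
      have "edge_length k (q i) A \<le> R powr q i * (real (card A))\<^sup>2"
        using A R q[OF i] by (intro edge_length_le) auto
      then have "\<bar>\<alpha> i\<bar> * (s powr (q i / DIM('a)) * edge_length k (q i) A) \<le>
          \<bar>\<alpha> i\<bar> * (s powr (q i / DIM('a)) * (R powr q i * (real (card A))\<^sup>2))"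
        by (intro mult_left_mono) auto
      moreover have "\<bar>\<alpha> i * (s powr (q i / DIM('a)) * edge_length k (q i) A)\<bar> =
          \<bar>\<alpha> i\<bar> * (s powr (q i / DIM('a)) * edge_length k (q i) A)"
        using edge_length_nonneg[of k "q i" A] by (simp add: abs_mult)
      ultimately show "\<bar>\<alpha> i * (s powr (q i / DIM('a)) * edge_length k (q i) A)\<bar> \<le>
          \<bar>\<alpha> i\<bar> * (s powr (q i / DIM('a)) * R powr q i) * (real (card A))\<^sup>2"
        by (simp add: mult.assoc)
    qed
    finally show "\<bar>scaled_edge_length k s I \<alpha> q A\<bar> \<le> ?b * (real (card A))\<^sup>2"
      by (simp add: sum_distrib_right)
  qed
qed

context finite_poisson_process
begin

text \<open>The counts of \<open>X \<omega> - D\<close> are counts of \<open>X \<omega>\<close> on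
  subsets of \<open>- D\<close>, and \<open>measurable_edge_length\<close> holds for an arbitrary
  \<open>N\<close>, in particular for the small sigma-algebra \<open>inside (- D)\<close>.\<close>

lemma measurable_scaled_edge_length_Diff:
  assumes D: "D \<in> sets borel"
  shows "(\<lambda>\<omega>. scaled_edge_length k s I \<alpha> q (X \<omega> - D)) \<in> borel_measurable (inside (- D))"
  unfolding scaled_edge_length_def
proof (intro borel_measurable_sum borel_measurable_times borel_measurable_const measurable_edge_length)
  fix B :: "'a set" assume "B \<in> sets borel"
  then have "(\<lambda>\<omega>. point_count (B \<inter> - D) (X \<omega>)) \<in> borel_measurable (inside (- D))"
    using D by (intro measurable_point_count_inside) auto
  then show "(\<lambda>\<omega>. point_count B (X \<omega> - D)) \<in> borel_measurable (inside (- D))"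
    by (simp add: Diff_eq point_count_Int)
qed

lemma integrable_scaled_edge_length:
  assumes I: "finite I" and q: "\<And>i. i \<in> I \<Longrightarrow> q i \<ge> 0" and V: "bounded V"
    and XV: "AE \<omega> in M. X \<omega> \<subseteq> V" and D: "D \<in> sets borel"
  shows "integrable M (\<lambda>\<omega>. scaled_edge_length k s I \<alpha> q (X \<omega> - D))"
    and "integrable M (\<lambda>\<omega>. (scaled_edge_length k s I \<alpha> q (X \<omega> - D))\<^sup>2)"
proof -
  let ?h = "\<lambda>\<omega>. scaled_edge_length k s I \<alpha> q (X \<omega> - D)"
  from scaled_edge_length_bound[OF I q V, where k = k and s = s and \<alpha> = \<alpha>]
  obtain b where "b \<ge> 0 \<and> (\<forall>A. finite A \<longrightarrow> A \<subseteq> V \<longrightarrow>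
      \<bar>scaled_edge_length k s I \<alpha> q A\<bar> \<le> b * (real (card A))\<^sup>2)" ..
  note b = conjunct1[OF this] conjunct2[OF this, rule_format]
  have m: "?h \<in> borel_measurable M"
    by (rule measurable_inside_imp[OF measurable_scaled_edge_length_Diff[OF D]])
  have bound: "AE \<omega> in M. \<bar>?h \<omega>\<bar> \<le> b * (real (card (X \<omega>)))\<^sup>2"
    using XV AE_finite
  proof eventually_elim
    case (elim \<omega>)
    have "\<bar>?h \<omega>\<bar> \<le> b * (real (card (X \<omega> - D)))\<^sup>2"
    proof (rule b(2))
      show "finite (X \<omega> - D)" using elim by simp
      show "X \<omega> - D \<subseteq> V" using elim by blast
    qed
    also have "\<dots> \<le> b * (real (card (X \<omega>)))\<^sup>2"
      using elim b(1) by (intro mult_left_mono power_mono) (auto intro: card_mono)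
    finally show ?case .
  qed
  show "integrable M ?h"
  proof (rule Bochner_Integration.integrable_bound[OF _ m])
    show "integrable M (\<lambda>\<omega>. b * real (card (X \<omega>)) ^ 4)" using integrable_card_power by simp
    show "AE \<omega> in M. norm (?h \<omega>) \<le> norm (b * real (card (X \<omega>)) ^ 4)"
      using bound
    proof eventually_elim
      case (elim \<omega>)
      have "card (X \<omega>) ^ 2 \<le> card (X \<omega>) ^ 4"
        by (cases "card (X \<omega>) = 0") (auto intro: power_increasing)
      then have "real (card (X \<omega>)) ^ 2 \<le> real (card (X \<omega>)) ^ 4" by (metis of_nat_le_iff of_nat_power)
      then have "b * real (card (X \<omega>)) ^ 2 \<le> b * real (card (X \<omega>)) ^ 4" using b(1) by (rule mult_left_mono)
      then show ?case using elim b(1) by simp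
    qed
  qed
  show "integrable M (\<lambda>\<omega>. (?h \<omega>)\<^sup>2)"
  proof (rule Bochner_Integration.integrable_bound)
    show "integrable M (\<lambda>\<omega>. b\<^sup>2 * real (card (X \<omega>)) ^ 4)" using integrable_card_power by simp
    show "(\<lambda>\<omega>. (?h \<omega>)\<^sup>2) \<in> borel_measurable M" using m by (rule borel_measurable_power)
    show "AE \<omega> in M. norm ((?h \<omega>)\<^sup>2) \<le> norm (b\<^sup>2 * real (card (X \<omega>)) ^ 4)"
      using bound
    proof eventually_elim
      case (elim \<omega>)
      then have "\<bar>?h \<omega>\<bar>\<^sup>2 \<le> (b * (real (card (X \<omega>)))\<^sup>2)\<^sup>2" by (rule power_mono) simp
      then show ?case by (simp add: power_mult_distrib flip: power_mult)
    qed
  qed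
qed

end

subsection \<open>Test functions\<close>

text \<open>The pattern at one intensity \<open>s\<close>; \<open>V\<close> will be
  \<open>W\<close>. By \<open>st\<close>, \<open>r\<close> is the length \<open>t\<close> in units
  of \<open>s powr (- 1 / DIM('a))\<close>. As \<open>r\<close>, \<open>\<delta>\<close> and
  \<open>P\<close> will be chosen independently of \<open>s\<close>, the probabilities defined below
  do not depend on \<open>s\<close>.\<close>

locale core_pattern = finite_poisson_process M \<mu> X
  for M :: "'w measure" and \<mu> :: "'a::euclidean_space measure" and X :: "'w \<Rightarrow> 'a set" +
  fixes V P :: "'a set" and e :: 'a and s t r \<delta> :: real and k :: nat
  assumes pos: "s > 0" "t > 0" "r > 0" and st: "s powr (1 / DIM('a)) * t = r"
    and V: "V \<in> sets borel"
    and intensity: "\<And>B. B \<in> sets borel \<Longrightarrow> B \<subseteq> V \<Longrightarrow> measure \<mu> B = s * measure lborel B"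
    and P: "finite P" "P \<noteq> {}" "\<And>p. p \<in> P \<Longrightarrow> norm p = 1"
    and \<delta>: "0 < \<delta>" "\<delta> \<le> 1 / 8"
    and P_sep: "\<And>p p'. p \<in> P \<Longrightarrow> p' \<in> P \<Longrightarrow> p \<noteq> p' \<Longrightarrow> 2 * \<delta> < norm (p - p')"
    and e: "norm e = 1"
begin

definition core1 :: "'a \<Rightarrow> 'a set" where "core1 x = ball (x + (t / 8) *\<^sub>R e) (t / 16)"
definition core2 :: "'a \<Rightarrow> 'a set" where "core2 x = ball (x - (t / 8) *\<^sub>R e) (t / 16)"
definition core :: "'a \<Rightarrow> 'a set" where "core x = core1 x \<union> core2 x"
definition cluster :: "'a \<Rightarrow> 'a \<Rightarrow> 'a set" where "cluster x p = cball (x + t *\<^sub>R p) (t * \<delta>)"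
definition shell :: "'a \<Rightarrow> 'a set" where "shell x = ball x (3 * t / 4) - core x"

definition core_counts :: "nat \<Rightarrow> nat \<Rightarrow> 'a \<Rightarrow> 'w set" where
  "core_counts i j x =
     {\<omega>\<in>space M. point_count (core1 x) (X \<omega>) = of_nat i \<and> point_count (core2 x) (X \<omega>) = of_nat j}"

definition isolated :: "'a \<Rightarrow> 'w set" where
  "isolated x = {\<omega>\<in>space M. point_count (shell x) (X \<omega>) = of_nat 0 \<and>
     (\<forall>p\<in>P. point_count (cluster x p) (X \<omega>) = of_nat (k + 2))}"

definition poisson_weight :: "real \<Rightarrow> nat \<Rightarrow> real" where
  "poisson_weight m j = exp (- m) * m ^ j / fact j"

text \<open>The intensity measure of a ball of radius \<open>t * a\<close> in \<open>V\<close>; the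
  identity \<open>s * t ^ DIM('a) = r ^ DIM('a)\<close> has removed \<open>s\<close>.\<close>

definition vol :: "real \<Rightarrow> real" where
  "vol a = unit_ball_vol (DIM('a)) * (r * a) ^ DIM('a)"

definition full_prob :: real where
  "full_prob = poisson_weight (vol (1 / 16)) 1 * poisson_weight (vol (1 / 16)) k"

definition empty_prob :: real where
  "empty_prob = poisson_weight (vol (1 / 16)) 0 * poisson_weight (vol (1 / 16)) 0"

text \<open>Only a lower bound for the probability of \<open>isolated x\<close>: the shell has volume at most that of a ball of radius \<open>t\<close>.\<close>
definition isolated_prob :: real where
  "isolated_prob = exp (- vol 1) * poisson_weight (vol \<delta>) (k + 2) ^ card P"

text \<open>
  Given the configuration outside of the core, the two normalized indicators have the same
  expectation, so the test function is uncorrelated with everything that ignores the core.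
\<close>
definition test_function :: "'a \<Rightarrow> 'w \<Rightarrow> real" where
  "test_function x \<omega> = indicator (isolated x) \<omega> *
     (indicator (core_counts 1 k x) \<omega> / full_prob - indicator (core_counts 0 0 x) \<omega> / empty_prob)"

lemma pattern_sets [measurable]:
  "core1 x \<in> sets borel" "core2 x \<in> sets borel" "core x \<in> sets borel"
  "cluster x p \<in> sets borel" "shell x \<in> sets borel"
  by (auto simp: core1_def core2_def core_def cluster_def shell_def)

section \<open>Geometry of the pattern\<close>

lemma norm_pattern_directions: "norm ((t / 8) *\<^sub>R e) = t / 8" "p \<in> P \<Longrightarrow> norm (t *\<^sub>R p) = t"
  using pos e P by simp_all

lemma in_core1D: "y \<in> core1 x \<Longrightarrow> norm (y - (x + (t / 8) *\<^sub>R e)) < t / 16"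
  and in_core2D: "y \<in> core2 x \<Longrightarrow> norm (y - (x - (t / 8) *\<^sub>R e)) < t / 16"
  and in_clusterD: "y \<in> cluster x p \<Longrightarrow> norm (y - (x + t *\<^sub>R p)) \<le> t * \<delta>"
  unfolding core1_def core2_def cluster_def mem_ball mem_cball dist_norm
  by (simp_all only: norm_minus_commute)

lemma core_disjoint: "core1 x \<inter> core2 x = {}"
proof (rule ccontr)
  assume "core1 x \<inter> core2 x \<noteq> {}"
  then obtain y where y: "y \<in> core1 x" "y \<in> core2 x" by blast
  have "(t / 8) *\<^sub>R e + (t / 8) *\<^sub>R e = (y - (x - (t / 8) *\<^sub>R e)) - (y - (x + (t / 8) *\<^sub>R e))"
    by simp
  then have "norm ((t / 8) *\<^sub>R e + (t / 8) *\<^sub>R e) \<le>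
      norm (y - (x - (t / 8) *\<^sub>R e)) + norm (y - (x + (t / 8) *\<^sub>R e))"
    by (metis norm_triangle_ineq4)
  moreover have "(t / 8) *\<^sub>R e + (t / 8) *\<^sub>R e = (t / 4) *\<^sub>R e" by (simp flip: scaleR_add_left)
  moreover have "norm ((t / 4) *\<^sub>R e) = t / 4" using pos e by simp
  ultimately show False using in_core1D[OF y(1)] in_core2D[OF y(2)] pos by simp
qed

lemma core_subset: "core x \<subseteq> ball x (3 * t / 16)"
proof
  fix y assume "y \<in> core x"
  then consider "y \<in> core1 x" | "y \<in> core2 x" by (auto simp: core_def)
  then have "norm (y - x) < 3 * t / 16"
  proof cases
    case 1
    then show ?thesis
      using in_core1D[OF 1] norm_pattern_directions(1)
        norm_triangle_ineq[of "y - (x + (t / 8) *\<^sub>R e)" "(t / 8) *\<^sub>R e"] by simp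
  next
    case 2
    then show ?thesis
      using in_core2D[OF 2] norm_pattern_directions(1)
        norm_triangle_ineq4[of "y - (x - (t / 8) *\<^sub>R e)" "(t / 8) *\<^sub>R e"] by simp
  qed
  then show "y \<in> ball x (3 * t / 16)" by (simp add: dist_norm norm_minus_commute)
qed

text \<open>As \<open>\<delta> \<le> 1 / 8\<close>, the clusters stay clear of the ball of radius
  \<open>3 * t / 4\<close> that holds core and shell, and inside the ball of radius
  \<open>2 * t\<close> reserved for \<open>x\<close>.\<close>

lemma in_cluster_norm:
  assumes "p \<in> P" and "y \<in> cluster x p"
  shows "7 * t / 8 \<le> norm (y - x)" and "norm (y - x) \<le> 9 * t / 8"
proof -
  have t\<delta>: "t * \<delta> \<le> t / 8" using pos \<delta> by simp
  have y: "norm (y - (x + t *\<^sub>R p)) \<le> t / 8" using in_clusterD[OF assms(2)] t\<delta> by linarith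
  have nt: "norm (t *\<^sub>R p) = t" using norm_pattern_directions(2)[OF assms(1)] .
  have "norm (t *\<^sub>R p) \<le> norm (y - x) + norm (y - (x + t *\<^sub>R p))"
    using norm_triangle_ineq4[of "y - x" "y - (x + t *\<^sub>R p)"] by simp
  then show "7 * t / 8 \<le> norm (y - x)" using y nt by simp
  have "norm (y - x) \<le> norm (y - (x + t *\<^sub>R p)) + norm (t *\<^sub>R p)"
    using norm_triangle_ineq[of "y - (x + t *\<^sub>R p)" "t *\<^sub>R p"] by simp
  then show "norm (y - x) \<le> 9 * t / 8" using y nt by simp
qed

text \<open>Prepares two kinds of independence: the test function of \<open>x\<close> depends only
  on the points in \<open>ball x (2 * t)\<close>, and \<open>isolated x\<close> only on those
  outside of the core, hence not on the core counts.\<close>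

lemma pattern_subset:
  "core x \<subseteq> ball x (2 * t)" "shell x \<subseteq> ball x (2 * t) - core x"
  "p \<in> P \<Longrightarrow> cluster x p \<subseteq> ball x (2 * t) - core x"
proof -
  show "core x \<subseteq> ball x (2 * t)" using core_subset[of x] pos by auto
  show "shell x \<subseteq> ball x (2 * t) - core x" using pos by (auto simp: shell_def)
  show "cluster x p \<subseteq> ball x (2 * t) - core x" if "p \<in> P"
  proof
    fix y assume "y \<in> cluster x p"
    note y = in_cluster_norm[OF that this]
    have "y \<notin> core x"
    proof
      assume "y \<in> core x"
      then have "norm (y - x) < 3 * t / 16"
        using core_subset[of x] by (auto simp: dist_norm norm_minus_commute)
      then show False using y pos by simp
    qed
    then show "y \<in> ball x (2 * t) - core x" using y(2) pos by (simp add: dist_norm norm_minus_commute)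
  qed
qed

lemma shell_cluster_disjoint: "p \<in> P \<Longrightarrow> shell x \<inter> cluster x p = {}"
proof (rule ccontr)
  assume p: "p \<in> P" and "shell x \<inter> cluster x p \<noteq> {}"
  then obtain y where y: "y \<in> shell x" "y \<in> cluster x p" by blast
  have "norm (y - x) < 3 * t / 4" using y(1) by (simp add: shell_def dist_norm norm_minus_commute)
  then show False using in_cluster_norm(1)[OF p y(2)] pos by simp
qed

lemma cluster_disjoint:
  assumes "p \<in> P" "p' \<in> P" "p \<noteq> p'"
  shows "cluster x p \<inter> cluster x p' = {}"
proof (rule ccontr)
  assume "cluster x p \<inter> cluster x p' \<noteq> {}"
  then obtain y where y: "y \<in> cluster x p" "y \<in> cluster x p'" by blast
  have "t *\<^sub>R (p - p') = (y - (x + t *\<^sub>R p')) - (y - (x + t *\<^sub>R p))"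
    by (simp add: algebra_simps)
  then have "norm (t *\<^sub>R (p - p')) \<le> norm (y - (x + t *\<^sub>R p')) + norm (y - (x + t *\<^sub>R p))"
    by (metis norm_triangle_ineq4)
  also have "\<dots> \<le> t * \<delta> + t * \<delta>" using in_clusterD[OF y(2)] in_clusterD[OF y(1)] by (rule add_mono)
  finally have "t * norm (p - p') \<le> t * (2 * \<delta>)" using pos by (simp add: mult_ac)
  then have "norm (p - p') \<le> 2 * \<delta>" using pos by simp
  then show False using P_sep[OF assms] by simp
qed

section \<open>Probabilities of the pattern\<close>

lemma scale_vol: "a \<ge> 0 \<Longrightarrow> s * (unit_ball_vol (DIM('a)) * (t * a) ^ DIM('a)) = vol a"
proof -
  have "s = (s powr (1 / DIM('a))) ^ DIM('a)"
    using pos by (simp add: powr_power)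
  then have "s * (t * a) ^ DIM('a) = (s powr (1 / DIM('a)) * t * a) ^ DIM('a)"
    by (metis mult.assoc power_mult_distrib)
  then show ?thesis unfolding vol_def st by (simp add: mult.left_commute)
qed

lemma measure_ball_pattern:
  assumes "a \<ge> 0" and "ball c (t * a) \<subseteq> V"
  shows "measure \<mu> (ball c (t * a)) = vol a"
  using intensity[OF _ assms(2)] scale_vol[OF assms(1)] content_ball[of "t * a" c] pos assms(1) by simp

lemma measure_cball_pattern:
  assumes "a \<ge> 0" and "cball c (t * a) \<subseteq> V"
  shows "measure \<mu> (cball c (t * a)) = vol a"
  using intensity[OF _ assms(2)] scale_vol[OF assms(1)] content_cball[of "t * a" c] pos assms(1) by simp

lemma vol_pos: "a > 0 \<Longrightarrow> vol a > 0"
  unfolding vol_def using pos by simp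

lemma poisson_weight_pos: "m > 0 \<Longrightarrow> poisson_weight m j > 0"
  by (simp add: poisson_weight_def)

lemma probs_pos: "full_prob > 0" "empty_prob > 0" "isolated_prob > 0"
  unfolding full_prob_def empty_prob_def isolated_prob_def
  using \<delta> by (auto intro!: mult_pos_pos zero_less_power poisson_weight_pos vol_pos)

lemma prob_core_counts:
  assumes "ball x (2 * t) \<subseteq> V"
  shows "prob (core_counts i j x) = poisson_weight (vol (1 / 16)) i * poisson_weight (vol (1 / 16)) j"
proof -
  let ?B = "\<lambda>b. if b then core1 x else core2 x" and ?j = "\<lambda>b. if b then i else j"
  have "core x \<subseteq> V" using pattern_subset(1) assms by blast
  then have m: "measure \<mu> (core1 x) = vol (1 / 16)" "measure \<mu> (core2 x) = vol (1 / 16)"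
    using measure_ball_pattern[of "1 / 16" "x + (t / 8) *\<^sub>R e"]
      measure_ball_pattern[of "1 / 16" "x - (t / 8) *\<^sub>R e"]
    by (simp_all add: core_def core1_def core2_def)
  have "prob {\<omega>\<in>space M. \<forall>b\<in>UNIV. point_count (?B b) (X \<omega>) = of_nat (?j b)} =
      (\<Prod>b\<in>UNIV. exp (- measure \<mu> (?B b)) * measure \<mu> (?B b) ^ ?j b / fact (?j b))"
    using core_disjoint by (intro prob_point_counts) (auto simp: disjoint_family_on_def)
  also have "{\<omega>\<in>space M. \<forall>b\<in>UNIV. point_count (?B b) (X \<omega>) = of_nat (?j b)} = core_counts i j x"
    by (auto simp: core_counts_def UNIV_bool)
  also have "(\<Prod>b\<in>UNIV. exp (- measure \<mu> (?B b)) * measure \<mu> (?B b) ^ ?j b / fact (?j b)) =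
      poisson_weight (vol (1 / 16)) i * poisson_weight (vol (1 / 16)) j"
    by (simp add: UNIV_bool m poisson_weight_def mult_ac)
  finally show ?thesis .
qed

lemma prob_isolated_ge:
  assumes "ball x (2 * t) \<subseteq> V"
  shows "isolated_prob \<le> prob (isolated x)"
proof -
  \<comment> \<open>\<open>None\<close> is the index of the shell and \<open>Some p\<close> that of
    the cluster at \<open>p\<close>; these sets are pairwise disjoint, so their counts are
    independent.\<close>
  let ?B = "case_option (shell x) (cluster x)" and ?j = "case_option 0 (\<lambda>_. k + 2)"
  let ?K = "insert None (Some ` P)"
  let ?f = "\<lambda>b. exp (- measure \<mu> (?B b)) * measure \<mu> (?B b) ^ ?j b / fact (?j b)"
  have "prob {\<omega>\<in>space M. \<forall>b\<in>?K. point_count (?B b) (X \<omega>) = of_nat (?j b)} = (\<Prod>b\<in>?K. ?f b)"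
  proof (rule prob_point_counts)
    show "disjoint_family_on ?B ?K"
      unfolding disjoint_family_on_def
    proof (intro ballI impI)
      fix b c assume "b \<in> ?K" "c \<in> ?K" "b \<noteq> c"
      then show "?B b \<inter> ?B c = {}"
        using shell_cluster_disjoint[of "the b" x] shell_cluster_disjoint[of "the c" x]
          cluster_disjoint[of "the b" "the c" x]
        by (cases b; cases c) auto
    qed
    show "?B b \<in> sets borel" if "b \<in> ?K" for b by (cases b) auto
  qed (use P in auto)
  moreover have "{\<omega>\<in>space M. \<forall>b\<in>?K. point_count (?B b) (X \<omega>) = of_nat (?j b)} = isolated x"
    unfolding isolated_def by auto
  moreover have "(\<Prod>b\<in>?K. ?f b) = exp (- measure \<mu> (shell x)) * (\<Prod>p\<in>P. ?f (Some p))"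
    using P(1) by (subst prod.insert) (auto simp: prod.reindex)
  moreover have "(\<Prod>p\<in>P. ?f (Some p)) = poisson_weight (vol \<delta>) (k + 2) ^ card P"
  proof -
    have "?f (Some p) = poisson_weight (vol \<delta>) (k + 2)" if "p \<in> P" for p
    proof -
      have "cluster x p \<subseteq> V" using pattern_subset(3)[OF that] assms by blast
      then have "measure \<mu> (cluster x p) = vol \<delta>"
        unfolding cluster_def using \<delta> by (intro measure_cball_pattern) auto
      then show ?thesis by (simp add: poisson_weight_def)
    qed
    then show ?thesis by simp
  qed
  moreover have "exp (- vol 1) \<le> exp (- measure \<mu> (shell x))"
  proof -
    have bV: "ball x (t * 1) \<subseteq> V" using assms subset_ball[of t "2 * t" x] pos by auto
    have sub: "shell x \<subseteq> ball x (t * 1)" using pos by (auto simp: shell_def)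
    have "emeasure \<mu> (ball x (t * 1)) \<le> emeasure \<mu> UNIV" by (intro emeasure_mono) auto
    then have "emeasure \<mu> (ball x (t * 1)) < \<infinity>" using finite_intensity by (rule le_less_trans)
    then have "measure \<mu> (shell x) \<le> measure \<mu> (ball x (t * 1))"
      using sub by (intro measure_mono_fmeasurable) (auto simp: fmeasurable_def)
    also have "\<dots> = vol 1" by (rule measure_ball_pattern) (use bV in auto)
    finally show ?thesis by simp
  qed
  moreover have "poisson_weight (vol \<delta>) (k + 2) ^ card P \<ge> 0"
    using poisson_weight_pos[OF vol_pos[OF \<delta>(1)]] by (simp add: less_imp_le)
  ultimately show ?thesis unfolding isolated_prob_def by (simp add: mult_right_mono)
qed

section \<open>Covariances with the test functions\<close>

lemma point_count_event_inside:
  "B \<in> sets borel \<Longrightarrow> B \<subseteq> D \<Longrightarrow> {\<omega>\<in>space (inside D). point_count B (X \<omega>) = c} \<in> sets (inside D)"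
  using measurable_sets[OF measurable_point_count_inside, of B D "{c}"]
  by (simp add: vimage_def Int_def conj_commute)

lemma core_counts_inside: "core x \<subseteq> D \<Longrightarrow> core_counts i j x \<in> sets (inside D)"
  unfolding core_counts_def space_inside[of D, symmetric]
  by (intro sets.sets_Collect_conj point_count_event_inside pattern_sets) (auto simp: core_def)

lemma isolated_inside:
  assumes "ball x (2 * t) - core x \<subseteq> D"
  shows "isolated x \<in> sets (inside D)"
  unfolding isolated_def space_inside[of D, symmetric]
proof (intro sets.sets_Collect_conj sets.sets_Collect_finite_All P(1) point_count_event_inside pattern_sets)
  show "shell x \<subseteq> D" using pattern_subset(2) assms by blast
  show "cluster x p \<subseteq> D" if "p \<in> P" for p using pattern_subset(3)[OF that] assms by blast
qed

lemma test_function_inside: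
  assumes "ball x (2 * t) \<subseteq> D"
  shows "test_function x \<in> borel_measurable (inside D)"
proof -
  have [measurable]: "isolated x \<in> sets (inside D)" using assms by (intro isolated_inside) auto
  have [measurable]: "core_counts i j x \<in> sets (inside D)" for i j
    using assms pattern_subset(1)[of x] by (intro core_counts_inside) auto
  show ?thesis unfolding test_function_def[abs_def] by measurable
qed

lemma test_function_measurable: "test_function x \<in> borel_measurable M"
  by (rule measurable_inside_imp[OF test_function_inside[of x UNIV]]) simp

lemma test_function_bound: "\<bar>test_function x \<omega>\<bar> \<le> 1 / full_prob + 1 / empty_prob"
proof -
  have "\<bar>a - b\<bar> \<le> a + b" if "0 \<le> a" "0 \<le> b" for a b :: real using that by arith
  then have "\<bar>1 / full_prob - 1 / empty_prob\<bar> \<le> 1 / full_prob + 1 / empty_prob"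
    using probs_pos by simp
  then show ?thesis using probs_pos by (auto simp: test_function_def indicator_def)
qed

text \<open>Multiplied by the indicator of \<open>isolated x\<close>, \<open>U\<close> is still
  independent of the counts in the core, so both halves of the test function give the same
  expectation. It is applied to a constant, to the test function of another grid point, and to the
  functional of \<open>X \<omega> - core x\<close>.\<close>

lemma expectation_mult_test_function:
  assumes x: "ball x (2 * t) \<subseteq> V"
    and U: "U \<in> borel_measurable (inside (- core x))" and int: "integrable M U"
  shows "expectation (\<lambda>\<omega>. U \<omega> * test_function x \<omega>) = 0"
proof -
  let ?U = "\<lambda>\<omega>. indicator (isolated x) \<omega> * U \<omega>"
  have I: "isolated x \<in> sets (inside (- core x))" by (rule isolated_inside) auto
  have IM: "isolated x \<in> events" using I sets_inside_subset by blast
  have U': "?U \<in> borel_measurable (inside (- core x))"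
    using I U by (intro borel_measurable_times) auto
  have int': "integrable M ?U"
    using integrable_mult_indicator[OF IM int] by simp
  have CM: "core_counts i j x \<in> events" for i j
    using core_counts_inside[of x UNIV i j] sets_inside_subset by blast
  have E: "(\<integral>\<omega>. indicator (core_counts i j x) \<omega> * ?U \<omega> \<partial>M) = prob (core_counts i j x) * expectation ?U" for i j
    by (rule integral_indicator_mult_inside[OF _ _ _ core_counts_inside[OF order_refl] U' int']) auto
  have intE: "integrable M (\<lambda>\<omega>. indicator (core_counts i j x) \<omega> * ?U \<omega>)" for i j
    using integrable_mult_indicator[OF CM int', of i j] by simp
  have "(\<lambda>\<omega>. U \<omega> * test_function x \<omega>) = (\<lambda>\<omega>.
      indicator (core_counts 1 k x) \<omega> * ?U \<omega> / full_prob - indicator (core_counts 0 0 x) \<omega> * ?U \<omega> / empty_prob)"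
    by (simp add: test_function_def fun_eq_iff right_diff_distrib mult_ac)
  then have "expectation (\<lambda>\<omega>. U \<omega> * test_function x \<omega>) =
      (\<integral>\<omega>. indicator (core_counts 1 k x) \<omega> * ?U \<omega> \<partial>M) / full_prob -
      (\<integral>\<omega>. indicator (core_counts 0 0 x) \<omega> * ?U \<omega> \<partial>M) / empty_prob"
    using intE[of 1 k] intE[of 0 0] by simp
  also have "\<dots> = 0"
    unfolding E prob_core_counts[OF x] full_prob_def[symmetric] empty_prob_def[symmetric]
    using probs_pos by simp
  finally show ?thesis .
qed

lemma prob_isolated_full:
  assumes x: "ball x (2 * t) \<subseteq> V"
  shows "prob (isolated x \<inter> core_counts 1 k x) = full_prob * prob (isolated x)"
proof -
  have "prob (core_counts 1 k x \<inter> isolated x) = prob (core_counts 1 k x) * prob (isolated x)"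
    by (rule indep_setD[OF indep_inside[of "core x" "- core x"] core_counts_inside isolated_inside]) auto
  then show ?thesis using prob_core_counts[OF x] by (simp add: Int_commute full_prob_def)
qed

text \<open>\<open>h (X \<omega> - core x)\<close> is orthogonal to the test function, so only its
  difference to \<open>h (X \<omega>)\<close> counts. The difference is 0 where the core is empty;
  where it is full, it contributes at least \<open>\<beta> / full_prob\<close>, on an event of
  probability \<open>full_prob * prob (isolated x)\<close>.\<close>

lemma expectation_functional_test_function:
  assumes x: "ball x (2 * t) \<subseteq> V"
    and U: "(\<lambda>\<omega>. h (X \<omega> - core x)) \<in> borel_measurable (inside (- core x))"
    and int: "integrable M (\<lambda>\<omega>. h (X \<omega>))" "integrable M (\<lambda>\<omega>. h (X \<omega> - core x))"
    and gain: "\<And>A. finite A \<Longrightarrow> card (A \<inter> core1 x) = 1 \<Longrightarrow> card (A \<inter> core2 x) = k \<Longrightarrow> A \<inter> shell x = {} \<Longrightarrow>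
        (\<And>p. p \<in> P \<Longrightarrow> card (A \<inter> cluster x p) = k + 2) \<Longrightarrow> \<beta> \<le> \<sigma> * (h A - h (A - core x))"
    and \<beta>: "\<beta> \<ge> 0"
  shows "\<beta> * isolated_prob \<le> expectation (\<lambda>\<omega>. h (X \<omega>) * (\<sigma> * test_function x \<omega>))"
proof -
  let ?G = "isolated x \<inter> core_counts 1 k x"
  let ?T = "test_function x"
  have GM: "?G \<in> events"
    using core_counts_inside[of x UNIV 1 k] isolated_inside[of x UNIV] sets_inside_subset by blast
  have intT: "integrable M (\<lambda>\<omega>. g \<omega> * ?T \<omega>)" if g: "integrable M g" for g
  proof (rule Bochner_Integration.integrable_bound)
    show "integrable M (\<lambda>\<omega>. (1 / full_prob + 1 / empty_prob) * g \<omega>)" using g by simp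
    show "(\<lambda>\<omega>. g \<omega> * ?T \<omega>) \<in> borel_measurable M"
      using g test_function_measurable by (intro borel_measurable_times) auto
    show "AE \<omega> in M. norm (g \<omega> * ?T \<omega>) \<le> norm ((1 / full_prob + 1 / empty_prob) * g \<omega>)"
    proof (rule AE_I2)
      fix \<omega>
      have "\<bar>?T \<omega>\<bar> * \<bar>g \<omega>\<bar> \<le> (1 / full_prob + 1 / empty_prob) * \<bar>g \<omega>\<bar>"
        by (rule mult_right_mono[OF test_function_bound]) simp
      moreover have "\<bar>(1 / full_prob + 1 / empty_prob) * g \<omega>\<bar> = (1 / full_prob + 1 / empty_prob) * \<bar>g \<omega>\<bar>"
        using probs_pos by (simp add: abs_mult)
      moreover have "\<bar>g \<omega> * ?T \<omega>\<bar> = \<bar>?T \<omega>\<bar> * \<bar>g \<omega>\<bar>"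
        by (simp only: abs_mult mult.commute)
      ultimately show "norm (g \<omega> * ?T \<omega>) \<le> norm ((1 / full_prob + 1 / empty_prob) * g \<omega>)"
        unfolding real_norm_def by linarith
    qed
  qed
  have ae: "AE \<omega> in M. \<sigma> * (h (X \<omega> - core x) * ?T \<omega>) + \<beta> / full_prob * indicator ?G \<omega> \<le>
      \<sigma> * (h (X \<omega>) * ?T \<omega>)"
    using AE_finite
  proof eventually_elim
    case (elim \<omega>)
    show ?case
    proof (cases "\<omega> \<in> isolated x")
      case False
      then show ?thesis by (simp add: test_function_def)
    next
      case iso: True
      show ?thesis
      proof (cases "\<omega> \<in> core_counts 1 k x")
        case full: True
        have "\<omega> \<notin> core_counts 0 0 x" using full by (auto simp: core_counts_def)
        then have T: "?T \<omega> = 1 / full_prob" using iso full by (simp add: test_function_def)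
        have "\<beta> \<le> \<sigma> * (h (X \<omega>) - h (X \<omega> - core x))"
        proof (rule gain[OF elim])
          show "card (X \<omega> \<inter> core1 x) = 1" "card (X \<omega> \<inter> core2 x) = k"
            using full unfolding core_counts_def point_count_eq_iff by auto
          show "X \<omega> \<inter> shell x = {}"
            using iso elim unfolding isolated_def point_count_eq_iff by auto
          show "card (X \<omega> \<inter> cluster x p) = k + 2" if "p \<in> P" for p
            using iso that unfolding isolated_def point_count_eq_iff by auto
        qed
        then have "\<beta> / full_prob \<le> \<sigma> * (h (X \<omega>) - h (X \<omega> - core x)) / full_prob"
          using probs_pos(1) by (intro divide_right_mono) auto
        then show ?thesis using iso full T by (simp add: algebra_simps diff_divide_distrib)
      next
        case not_full: False
        show ?thesis
        proof (cases "\<omega> \<in> core_counts 0 0 x")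
          case True
          then have "X \<omega> \<inter> core1 x = {}" "X \<omega> \<inter> core2 x = {}"
            using elim unfolding core_counts_def point_count_eq_iff by auto
          then have "X \<omega> - core x = X \<omega>" by (auto simp: core_def)
          then show ?thesis using not_full by simp
        next
          case False
          then show ?thesis using not_full by (simp add: test_function_def)
        qed
      qed
    qed
  qed
  have "\<beta> * isolated_prob \<le> \<beta> * prob (isolated x)"
    using prob_isolated_ge[OF x] \<beta> by (rule mult_left_mono)
  also have "\<dots> = \<beta> / full_prob * prob ?G"
    using prob_isolated_full[OF x] probs_pos(1) by simp
  also have "\<dots> = expectation (\<lambda>\<omega>. \<sigma> * (h (X \<omega> - core x) * ?T \<omega>) + \<beta> / full_prob * indicator ?G \<omega>)"
  proof -
    have "integrable M (indicator ?G :: 'w \<Rightarrow> real)"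
      using GM by (intro integrable_real_indicator) (auto simp: emeasure_eq_measure)
    then have "expectation (\<lambda>\<omega>. \<sigma> * (h (X \<omega> - core x) * ?T \<omega>) + \<beta> / full_prob * indicator ?G \<omega>) =
        \<sigma> * expectation (\<lambda>\<omega>. h (X \<omega> - core x) * ?T \<omega>) + \<beta> / full_prob * expectation (indicator ?G)"
      using intT[OF int(2)] by simp
    then show ?thesis
      using expectation_mult_test_function[OF x U int(2)] GM by simp
  qed
  also have "\<dots> \<le> expectation (\<lambda>\<omega>. \<sigma> * (h (X \<omega>) * ?T \<omega>))"
  proof (rule integral_mono_AE[OF _ _ ae])
    show "integrable M (\<lambda>\<omega>. \<sigma> * (h (X \<omega> - core x) * ?T \<omega>) + \<beta> / full_prob * indicator ?G \<omega>)"
      using intT[OF int(2)] GM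
      by (intro Bochner_Integration.integrable_add integrable_mult_right integrable_real_indicator)
         (auto simp: emeasure_eq_measure)
    show "integrable M (\<lambda>\<omega>. \<sigma> * (h (X \<omega>) * ?T \<omega>))"
      using intT[OF int(1)] by simp
  qed
  also have "\<dots> = expectation (\<lambda>\<omega>. h (X \<omega>) * (\<sigma> * ?T \<omega>))" by (simp add: mult_ac)
  finally show ?thesis .
qed

text \<open>The test functions are multiplied by \<open>\<sigma>\<close> so that their covariances
  with the functional are positive whatever the sign of the leading coefficient.\<close>

lemma variance_scaled_edge_length_ge:
  fixes q \<alpha> :: "'i \<Rightarrow> real"
  assumes k: "k \<ge> 1" and I: "finite I" and q: "\<And>i. i \<in> I \<Longrightarrow> q i \<ge> 0"
    and bounded: "bounded V" and XV: "AE \<omega> in M. X \<omega> \<subseteq> V"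
    and net: "\<And>u. norm u = 1 \<Longrightarrow> \<exists>p\<in>P. norm (u - p) \<le> 1 / 8"
    and sgn: "\<And>\<tau>. 0 < \<tau> \<Longrightarrow> \<tau> \<le> r \<Longrightarrow> a * \<tau> powr p0 \<le> \<sigma> * (\<Sum>i\<in>I. \<alpha> i * \<tau> powr q i)"
    and \<sigma>: "\<bar>\<sigma>\<bar> = 1" and a: "a > 0" and p0: "p0 \<ge> 0"
    and Z: "finite Z" "\<And>x. x \<in> Z \<Longrightarrow> ball x (2 * t) \<subseteq> V"
    and Z_sep: "\<And>x x'. x \<in> Z \<Longrightarrow> x' \<in> Z \<Longrightarrow> x \<noteq> x' \<Longrightarrow> 4 * t \<le> dist x x'"
  shows "variance (\<lambda>\<omega>. scaled_edge_length k s I \<alpha> q (X \<omega>)) \<ge>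
    real (card Z) * ((a * (r / 8) powr p0 / 2 * isolated_prob)\<^sup>2 / (1 / full_prob + 1 / empty_prob)\<^sup>2)"
proof (rule variance_ge_uncorrelated_test_functions[where Y = "\<lambda>x \<omega>. \<sigma> * test_function x \<omega>"])
  let ?h = "scaled_edge_length k s I \<alpha> q :: 'a set \<Rightarrow> real"
  show "integrable M (\<lambda>\<omega>. ?h (X \<omega>))" "integrable M (\<lambda>\<omega>. (?h (X \<omega>))\<^sup>2)"
    using integrable_scaled_edge_length[OF I q bounded XV, where D = "{}"] by simp_all
  show "(\<lambda>\<omega>. \<sigma> * test_function x \<omega>) \<in> borel_measurable M" for x
    by (intro borel_measurable_times borel_measurable_const test_function_measurable)
  show "\<bar>\<sigma> * test_function x \<omega>\<bar> \<le> 1 / full_prob + 1 / empty_prob" for x \<omega>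
    using test_function_bound by (simp add: abs_mult \<sigma>)
  show "expectation (\<lambda>\<omega>. \<sigma> * test_function x \<omega>) = 0" if "x \<in> Z" for x
    by (rule expectation_mult_test_function[OF Z(2)[OF that]]) auto
  show "expectation (\<lambda>\<omega>. \<sigma> * test_function x \<omega> * (\<sigma> * test_function x' \<omega>)) = 0"
    if "x \<in> Z" "x' \<in> Z" "x \<noteq> x'" for x x'
  proof -
    \<comment> \<open>The separation \<open>4 * t\<close> is used here: the test function of
      \<open>x'\<close> sees only points outside of the core of \<open>x\<close>.\<close>
    have "ball x' (2 * t) \<inter> ball x (2 * t) = {}"
      using Z_sep[OF that] by (intro disjoint_ballI) (simp add: dist_commute)
    then have "ball x' (2 * t) \<subseteq> - core x" using pattern_subset(1)[of x] by blast
    then have m: "(\<lambda>\<omega>. \<sigma> * (\<sigma> * test_function x' \<omega>)) \<in> borel_measurable (inside (- core x))"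
      by (intro borel_measurable_times borel_measurable_const test_function_inside)
    have int: "integrable M (\<lambda>\<omega>. \<sigma> * (\<sigma> * test_function x' \<omega>))"
      by (intro integrable_mult_right integrable_const_bound[where B = "1 / full_prob + 1 / empty_prob"]
          test_function_measurable AE_I2) (simp add: test_function_bound)
    show ?thesis
      using expectation_mult_test_function[OF Z(2)[OF that(1)] m int] by (simp add: mult_ac)
  qed
  show "a * (r / 8) powr p0 / 2 * isolated_prob \<le>
      expectation (\<lambda>\<omega>. ?h (X \<omega>) * (\<sigma> * test_function x \<omega>))" if "x \<in> Z" for x
  proof (rule expectation_functional_test_function[OF Z(2)[OF that]])
    show "(\<lambda>\<omega>. ?h (X \<omega> - core x)) \<in> borel_measurable (inside (- core x))"
      by (rule measurable_scaled_edge_length_Diff) simp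
    show "integrable M (\<lambda>\<omega>. ?h (X \<omega>))"
      using integrable_scaled_edge_length(1)[OF I q bounded XV, where D = "{}"] by simp
    show "integrable M (\<lambda>\<omega>. ?h (X \<omega> - core x))"
      by (rule integrable_scaled_edge_length(1)[OF I q bounded XV]) auto
    show "0 \<le> a * (r / 8) powr p0 / 2" using a by simp
    fix A assume "finite A" "card (A \<inter> core1 x) = 1" "card (A \<inter> core2 x) = k" "A \<inter> shell x = {}"
      "\<And>p. p \<in> P \<Longrightarrow> card (A \<inter> cluster x p) = k + 2"
    then show "a * (r / 8) powr p0 / 2 \<le> \<sigma> * (?h A - ?h (A - core x))"
      unfolding core_def shell_def core1_def core2_def cluster_def
      by (intro scaled_edge_length_gain[OF pos(1,2) st e k sgn a p0 _ _ _ _ net P(3) \<delta>])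
  qed
  show "0 \<le> a * (r / 8) powr p0 / 2 * isolated_prob"
    using a probs_pos by simp
  show "0 < 1 / full_prob + 1 / empty_prob" using probs_pos by (intro add_pos_pos) auto
qed (fact Z(1))

end

section \<open>Choice of the constants and conclusion\<close>

theorem theorem3p3:
  fixes W :: "'a::euclidean_space set"
    and M :: "'w measure"
    and \<eta> :: "real \<Rightarrow> 'w \<Rightarrow> 'a set"
    and F :: "real \<Rightarrow> real \<Rightarrow> 'w \<Rightarrow> real"
    and k n :: nat
    and q \<alpha> :: "nat \<Rightarrow> real"
  assumes "W \<noteq> {}" and "compact W" and "convex W" and "emeasure lborel W > 0"
    and "\<And>s. s \<ge> 1 \<Longrightarrow>
           poisson_process M (density lborel (\<lambda>x. ennreal s * indicator W x)) (\<eta> s)"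
    and "k \<ge> 1"
    and "\<And>p s \<omega>. p \<ge> 0 \<Longrightarrow> s \<ge> 1 \<Longrightarrow> F p s \<omega> = s powr (p / DIM('a)) * edge_length k p (\<eta> s \<omega>)"
    and "n \<ge> 1" and "\<And>i. i \<in> {1..n} \<Longrightarrow> q i \<ge> 0" and "inj_on q {1..n}"
    and "\<exists>i\<in>{1..n}. \<alpha> i \<noteq> 0"
  shows "\<exists>c>0. eventually
           (\<lambda>s. prob_space.variance M (\<lambda>\<omega>. \<Sum>i=1..n. \<alpha> i * F (q i) s \<omega>) \<ge> c * s) at_top"
proof -
  let ?I = "{1..n}" and ?d = "real DIM('a)"
  note W = assms(2,3,4) and poisson = assms(5) and k = assms(6) and F = assms(7) and q = assms(9)
  obtain w \<rho> where w: "\<rho> > 0" "ball w \<rho> \<subseteq> W"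
    by (rule convex_positive_measure_contains_ball[OF W])
  obtain P :: "'a set" and \<delta> :: real where P: "finite P" "P \<noteq> {}" "\<And>p. p \<in> P \<Longrightarrow> norm p = 1"
    and net: "\<And>u. norm u = 1 \<Longrightarrow> \<exists>p\<in>P. norm (u - p) \<le> 1 / 8"
    and \<delta>: "0 < \<delta>" "\<delta> \<le> 1 / 8" "\<And>p p'. p \<in> P \<Longrightarrow> p' \<in> P \<Longrightarrow> p \<noteq> p' \<Longrightarrow> 2 * \<delta> < norm (p - p')"
    by (rule unit_sphere_net) blast
  obtain \<sigma> m a r where m: "m \<in> ?I" and \<sigma>: "\<bar>\<sigma>\<bar> = 1" and a: "a > 0" and r: "r > 0"
    and sgn: "\<And>\<tau>. 0 < \<tau> \<Longrightarrow> \<tau> \<le> r \<Longrightarrow> a * \<tau> powr q m \<le> \<sigma> * (\<Sum>i\<in>?I. \<alpha> i * \<tau> powr q i)"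
    by (rule generalized_polynomial_sign_near_0[OF _ assms(10,11)]) (simp, blast)
  obtain e :: 'a where e: "norm e = 1" using P(2,3) by blast
  \<comment> \<open>The constants of \<open>core_pattern\<close> are spelled out here because
    \<open>c\<close> has to be fixed before \<open>s\<close>, while the locale can be interpreted
    only for a given \<open>s\<close>.\<close>
  define v where "v = (\<lambda>a. unit_ball_vol ?d * (r * a) ^ DIM('a))"
  define pw where "pw = (\<lambda>m j. exp (- m) * m ^ j / fact j :: real)"
  define pf where "pf = pw (v (1 / 16)) 1 * pw (v (1 / 16)) k"
  define pe where "pe = pw (v (1 / 16)) 0 * pw (v (1 / 16)) 0"
  define p_iso where "p_iso = exp (- v 1) * pw (v \<delta>) (k + 2) ^ card P"
  have pw_pos: "pw (v b) j > 0" if "b > 0" for b j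
    using that r by (simp add: pw_def v_def)
  have pos: "pf > 0" "pe > 0" "p_iso > 0"
    using \<delta>(1) by (auto simp: pf_def pe_def p_iso_def intro!: mult_pos_pos zero_less_power pw_pos)
  define b where "b = (a * (r / 8) powr q m / 2 * p_iso)\<^sup>2 / (1 / pf + 1 / pe)\<^sup>2"
  have b: "b > 0"
  proof -
    have "1 / pf + 1 / pe > 0" using pos by (intro add_pos_pos) auto
    then show ?thesis using a r pos by (simp add: b_def)
  qed
  \<comment> \<open>\<open>b\<close> is the contribution of one grid point to the variance, and the
    first factor times \<open>s\<close> bounds the number of grid points from below.\<close>
  define c where "c = (\<rho> / (16 * ?d * r)) ^ DIM('a) * b"
  have "c > 0" using b w r by (simp add: c_def)
  moreover have "eventually
      (\<lambda>s. prob_space.variance M (\<lambda>\<omega>. \<Sum>i=1..n. \<alpha> i * F (q i) s \<omega>) \<ge> c * s) at_top"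
    \<comment> \<open>The second bound on \<open>s\<close> is the condition
      \<open>t \<le> \<rho> / (16 * ?d)\<close> of \<open>separated_points_in_ball\<close>, solved
      for \<open>s\<close>.\<close>
    using eventually_ge_at_top[of 1] eventually_ge_at_top[of "(r * (16 * ?d) / \<rho>) ^ DIM('a)"]
  proof eventually_elim
    case (elim s)
    define t where "t = r / s powr (1 / ?d)"
    let ?\<mu> = "density lborel (\<lambda>x. ennreal s * indicator W x)"
    have Wm [measurable]: "W \<in> sets borel" using W(1) by (simp add: borel_compact)
    have t0: "t > 0" using r elim(1) by (simp add: t_def)
    have st: "s powr (1 / ?d) * t = r" using elim(1) by (simp add: t_def)
    have s_eq: "s = (s powr (1 / ?d)) ^ DIM('a)" using elim(1) by (simp add: powr_power)
    have t_le: "t \<le> \<rho> / (16 * ?d)"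
    proof -
      have "(r * (16 * ?d) / \<rho>) ^ DIM('a) \<le> (s powr (1 / ?d)) ^ DIM('a)" using elim(2) s_eq by simp
      then have "r * (16 * ?d) / \<rho> \<le> s powr (1 / ?d)" 
        by (rule power_mono_iff[THEN iffD1, rotated 3]) (use r w(1) in auto)
      then show ?thesis using w(1) elim(1) by (simp add: t_def field_simps)
    qed
    have em: "emeasure ?\<mu> B = ennreal s * emeasure lborel (B \<inter> W)" if "B \<in> sets borel" for B
    proof -
      have "emeasure ?\<mu> B = (\<integral>\<^sup>+x. ennreal s * indicator (B \<inter> W) x \<partial>lborel)"
        using that by (subst emeasure_density) (auto intro!: nn_integral_cong simp: indicator_def)
      also have "\<dots> = ennreal s * emeasure lborel (B \<inter> W)"
        using that by (subst nn_integral_cmult_indicator) auto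
      finally show ?thesis .
    qed
    have finW: "emeasure lborel W < \<infinity>" using W(1) by (rule emeasure_compact_finite)
    interpret prob_space M using poisson[OF elim(1)] by (simp add: poisson_process_def)
    interpret finite_poisson_process M ?\<mu> "\<eta> s"
    proof
      show "poisson_process M ?\<mu> (\<eta> s)" by (rule poisson[OF elim(1)])
      show "emeasure ?\<mu> UNIV < \<infinity>" using em[of UNIV] finW by (simp add: ennreal_mult_less_top)
    qed simp
    interpret core_pattern M ?\<mu> "\<eta> s" W P e s t r \<delta> k
    proof
      show "s > 0" "t > 0" "r > 0" using elim(1) t0 r by auto
      show "measure ?\<mu> B = s * measure lborel B" if "B \<in> sets borel" "B \<subseteq> W" for B
        using em[OF that(1)] that elim(1) by (simp add: measure_def Int_absorb2 enn2real_mult)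
    qed (use st Wm P \<delta> e in auto)
    \<comment> \<open>The intensity measure of \<open>- W\<close> is 0. That the points almost
      surely lie in a bounded set is needed for the integrability of the functional.\<close>
    have "AE \<omega> in M. \<eta> s \<omega> \<inter> (- W) = {}"
      using em[of "- W"] by (intro AE_Int_null_set_empty) (auto simp: measure_def)
    then have XW: "AE \<omega> in M. \<eta> s \<omega> \<subseteq> W" by (rule eventually_mono) blast
    obtain Z where Z: "finite Z" "real (card Z) \<ge> (\<rho> / (16 * ?d * t)) ^ DIM('a)"
      "\<And>x. x \<in> Z \<Longrightarrow> ball x (2 * t) \<subseteq> ball w \<rho>"
      "\<And>x x'. x \<in> Z \<Longrightarrow> x' \<in> Z \<Longrightarrow> x \<noteq> x' \<Longrightarrow> 4 * t \<le> dist x x'"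
      by (rule separated_points_in_ball[OF w(1) t0 t_le, of w]) blast
    have probs: "full_prob = pf" "empty_prob = pe" "isolated_prob = p_iso"
      by (simp_all add: full_prob_def empty_prob_def isolated_prob_def poisson_weight_def vol_def
          pf_def pe_def p_iso_def pw_def v_def)
    have "c * s = (\<rho> / (16 * ?d * t)) ^ DIM('a) * b"
    proof -
      have "\<rho> / (16 * ?d * r) * s powr (1 / ?d) = \<rho> / (16 * ?d * t)"
        using r elim(1) by (simp add: t_def)
      then have "(\<rho> / (16 * ?d * r)) ^ DIM('a) * s = (\<rho> / (16 * ?d * t)) ^ DIM('a)"
        by (metis power_mult_distrib s_eq)
      then show ?thesis by (simp add: c_def mult_ac)
    qed
    also have "\<dots> \<le> real (card Z) * b" using Z(2) b by (intro mult_right_mono) auto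
    also have "\<dots> \<le> variance (\<lambda>\<omega>. scaled_edge_length k s ?I \<alpha> q (\<eta> s \<omega>))"
      unfolding b_def probs[symmetric]
    proof (rule variance_scaled_edge_length_ge[OF k _ q compact_imp_bounded[OF W(1)] XW net sgn \<sigma> a])
      show "q m \<ge> 0" using q m by simp
      show "ball x (2 * t) \<subseteq> W" if "x \<in> Z" for x using Z(3)[OF that] w(2) by blast
    qed (use Z in auto)
    also have "(\<lambda>\<omega>. scaled_edge_length k s ?I \<alpha> q (\<eta> s \<omega>)) = (\<lambda>\<omega>. \<Sum>i=1..n. \<alpha> i * F (q i) s \<omega>)"
      unfolding scaled_edge_length_def using F q elim(1) by (intro ext sum.cong refl) simp
    finally show ?case .
  qed
  ultimately show ?thesis by blast
qed

end
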